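(* Let $\mathbb{F}$ be an arbitrary field. (1) For every positive integer $n$ and every $M \in \mathrm{SL}_{2n}(\mathbb{F})$, there exist $A_1,\dots,A_6 \in \mathrm{M}_n(\mathbb{F})$ such that $$ M = \begin{bmatrix} I & 0 \\ A_1 & I \end{bmatrix} \begin{bmatrix} I & A_2 \\ 0 & I \end{bmatrix} \begin{bmatrix} I & 0 \\ A_3 & I \end{bmatrix} \begin{bmatrix} I & A_4 \\ 0 & I \end{bmatrix}\begin{bmatrix} I & 0 \\ A_5 & I \end{bmatrix} \begin{bmatrix} I & A_6 \\ 0 & I \end{bmatrix}.$$ (2) For all positive integers $m,n$ with $m+n>3$, there exists $M \in \mathrm{SL}_{m+n}(\mathbb{F})$ such that $M \notin \big[\mathrm{BL}_{m,n}(\mathbb{F}) \cup \mathrm{BU}_{m,n}(\mathbb{F})\big]^5$. (3) If, furthermore, $\mathbb{F}$ has at least four elements, then for all positive integers $m,n$ with $m+n>3$ there exists $M \in \mathrm{SL}_{m+n}(\mathbb{F})$ such that $P_{\pi} M P_{\pi^{-1}} \notin \big[\mathrm{BL}_{m,n}(\mathbb{F}) \cup \mathrm{BU}_{m,n}(\mathbb{F})\big]^5$ for all permutations $\pi \in \mathrm{S}_{m+n}$.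
   Context: $\mathrm{M}_{m,n}(\mathbb{F})$ is the set of $m\times n$ matrices over $\mathbb{F}$, and $\mathrm{M}_n(\mathbb{F})=\mathrm{M}_{n,n}(\mathbb{F})$. $\mathrm{SL}_n(\mathbb{F})$ is the group of $n\times n$ matrices over $\mathbb{F}$ with determinant one. $I$ and $0$ denote the identity and zero matrices of the dimensions dictated by context. $\mathrm{S}_n$ is the symmetric group, and $P_\pi$ denotes the permutation matrix obtained by permuting the columns of $I$ by $\pi$. For $X \subset \mathrm{M}_n(\mathbb{F})$, $X^k$ denotes the set of $k$-fold products $x_1x_2\cdots x_k$ of elements $x_i\in X$. The sets of block lower and block upper unitriangular matrices with block partition $\{1,\dots,m\}$, $\{m+1,\dots,m+n\}$ are $$\mathrm{BL}_{m,n}(\mathbb{F}) = \bigg\{ \begin{bmatrix} I & 0 \\ A & I \end{bmatrix} \,\bigg|\, A \in \mathrm{M}_{n,m}(\mathbb{F}) \bigg\},\qquad \mathrm{BU}_{m,n}(\mathbb{F})= \bigg\{ \begin{bmatrix} I & A \\ 0 & I \end{bmatrix} \,\bigg|\, A \in \mathrm{M}_{m,n}(\mathbb{F}) \bigg\},$$ both subgroups of $\mathrm{SL}_{m+n}(\mathbb{F})$ (upper left block $m\times m$, lower right block $n\times n$). *)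

theory Defs
  imports "Jordan_Normal_Form.Determinant"
begin

definition SL :: "nat \<Rightarrow> 'a::field mat set" where
  "SL n = {M \<in> carrier_mat n n. det M = 1}"

definition BL :: "nat \<Rightarrow> nat \<Rightarrow> 'a::field mat set" where
  "BL m n = {four_block_mat (1\<^sub>m m) (0\<^sub>m m n) A (1\<^sub>m n) | A. A \<in> carrier_mat n m}"

definition BU :: "nat \<Rightarrow> nat \<Rightarrow> 'a::field mat set" where
  "BU m n = {four_block_mat (1\<^sub>m m) A (0\<^sub>m n m) (1\<^sub>m n) | A. A \<in> carrier_mat m n}"

text \<open>The set of $k$-fold products of elements of a set \<open>X\<close> of matrices. The dimension is an
  argument only because matrix size is not part of the type, so the unit matrix has to be told it.\<close>

definition mat_set_power :: "nat \<Rightarrow> 'a::field mat set \<Rightarrow> nat \<Rightarrow> 'a mat set" where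
  "mat_set_power n X k = {foldr (*) xs (1\<^sub>m n) | xs. length xs = k \<and> set xs \<subseteq> X}"

text \<open>Column \<open>j\<close> of \<open>perm_mat n p\<close> is column \<open>p j\<close> of the unit matrix, with indices starting at
  \<open>0\<close>. The opposite convention would give \<open>perm_mat n (inv_into UNIV p)\<close>.\<close>

definition perm_mat :: "nat \<Rightarrow> (nat \<Rightarrow> nat) \<Rightarrow> 'a::field mat" where
  "perm_mat n p = mat n n (\<lambda>(i, j). 1\<^sub>m n $$ (i, p j))"

end

(* Five factors. A block diagonal matrix diag(A, D) that is a product of five factors satisfies
   A^-1 = 1 + z y and D = 1 + y z for some y, z. For A = 1 this forces (D - 1)^2 = 0, and for diagonal A and
   D it forces the entries different from 1 to occur in both blocks as mutual inverses. The first condition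
   excludes diag(1, D) with (D - 1)^2 nonzero, the second all conjugates of diag(a, a, a^-2, 1, ..., 1) by
   permutations, where a^2 is not 1.

   Six factors. A lower factor makes the lower left block C of M invertible, and an upper factor then turns
   the upper left block into any matrix. In this way M becomes a product of four further factors if and only
   if E (1 + a b) is similar to 1 + b a for some a, b, where E has determinant 1 and is determined by M.
   Every E has such a, b: a scalar E is a commutator, and otherwise E is similar to [[1, r], [s, R + s r]]
   with s nonzero and det R = 1, where R may be replaced by (1 + s w) R for any row w with w s = 0. If some
   (1 + s w) R is a commutator, suitable a, b can be written down. To make it one, write R = U L^-1 with U
   upper and L unit lower triangular in a basis starting with s, and choose an unreduced Hessenberg matrix C
   such that both L C and, after a change of the first row, U C are conjugate to a cyclic permutation
   matrix. *)
theory Submission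
  imports Defs
begin

section \<open>Matrix arithmetic with dimension side conditions\<close>

text \<open>The matrix E comes from comparing Schur complements. Once the upper left block is N = 1
  + b a, the complement of N is C N^-1 Q with Q = A C^-1 D - B, whereas a product of four factors
  has complement (1 + a b)^-1. Hence E = C Q, and the conjugation by C is absorbed into the
  similarity. For R = U L^-1 the substitution X = L C turns the pair X, R X into L C, U C. Two sets
  of m entries are free: the last column of C, which settles L C, and the first row of U C, which w
  changes. Each has as many entries as a characteristic polynomial has coefficients, so both
  matrices can be brought into one similarity class. The constraint w s = 0 then comes for free: as
  det R = 1, the two determinants agree, and so the change of the first row is a transvection. The
  cyclic matrix serves as the common target because it is invertible over every field, with its
  transpose as inverse.\<close>

lemma mat_mult_assoc:
  fixes A B C :: "'a::field mat"
  assumes "dim_col A = dim_row B" "dim_col B = dim_row C"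
  shows "A * B * C = A * (B * C)"
  using assms by (intro assoc_mult_mat[of _ "dim_row A" "dim_col A" _ "dim_row C" _ "dim_col C"]) auto

lemma mat_add_mult:
  fixes A B C :: "'a::field mat"
  assumes "dim_row A = dim_row B" "dim_col A = dim_col B" "dim_col B = dim_row C"
  shows "(A + B) * C = A * C + B * C"
  using assms by (intro add_mult_distrib_mat[of _ "dim_row A" "dim_col A" _ _ "dim_col C"]) auto

lemma mat_mult_add:
  fixes A B C :: "'a::field mat"
  assumes "dim_row B = dim_row C" "dim_col B = dim_col C" "dim_col A = dim_row B"
  shows "A * (B + C) = A * B + A * C"
  using assms by (intro mult_add_distrib_mat[of _ "dim_row A" "dim_col A" _ "dim_col C"]) auto

lemma mat_uminus_mult:
  fixes A B :: "'a::field mat"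
  assumes "dim_col A = dim_row B"
  shows "- A * B = - (A * B)"
  using assms by (intro uminus_mult_left_mat) auto

lemma mat_mult_uminus:
  fixes A B :: "'a::field mat"
  assumes "dim_col A = dim_row B"
  shows "A * - B = - (A * B)"
  using assms by (intro uminus_mult_right_mat) auto

lemma mat_add_assoc:
  fixes A B C :: "'a::field mat"
  assumes "dim_row A = dim_row B" "dim_col A = dim_col B" "dim_row B = dim_row C" "dim_col B = dim_col C"
  shows "A + B + C = A + (B + C)"
  using assms by (intro assoc_add_mat[of _ "dim_row A" "dim_col A"]) auto

lemma mat_add_commute:
  fixes A B :: "'a::field mat"
  assumes "dim_row A = dim_row B" "dim_col A = dim_col B"
  shows "A + B = B + A"
  using assms by (intro comm_add_mat[of _ "dim_row A" "dim_col A"]) auto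

lemma mat_add_left_commute:
  fixes A B C :: "'a::field mat"
  assumes "dim_row A = dim_row B" "dim_col A = dim_col B" "dim_row B = dim_row C" "dim_col B = dim_col C"
  shows "A + (B + C) = B + (A + C)"
  using assms by (intro eq_matI) auto

lemma mat_minus_eq:
  fixes A B :: "'a::field mat"
  assumes "dim_row A = dim_row B" "dim_col A = dim_col B"
  shows "A - B = A + - B"
  using assms by (intro eq_matI) auto

lemma mat_uminus_add:
  fixes A B :: "'a::field mat"
  assumes "dim_row A = dim_row B" "dim_col A = dim_col B"
  shows "- (A + B) = - A + - B"
  using assms by (intro eq_matI) auto

lemma mat_cancel:
  fixes A B :: "'a::field mat"
  shows "A + - A = 0\<^sub>m (dim_row A) (dim_col A)"
    "- A + A = 0\<^sub>m (dim_row A) (dim_col A)"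
    "\<lbrakk>dim_row A = dim_row B; dim_col A = dim_col B\<rbrakk> \<Longrightarrow> A + (- A + B) = B"
    "\<lbrakk>dim_row A = dim_row B; dim_col A = dim_col B\<rbrakk> \<Longrightarrow> - A + (A + B) = B"
    "\<lbrakk>dim_row A = dim_row B; dim_col A = dim_col B\<rbrakk> \<Longrightarrow> A + (B + - A) = B"
    "- (- A) = A"
    "- (0\<^sub>m nr nc :: 'a mat) = 0\<^sub>m nr nc"
  by (auto intro!: eq_matI)

text \<open>Rewriting with commutativity sorts summands by term order, which may leave
  \<open>A\<close> and \<open>- A\<close> one or two summands apart.\<close>

lemma mat_cancel_distant:
  fixes A B C E :: "'a::field mat"
  assumes "dim_row A = dim_row B" "dim_col A = dim_col B"
  shows "\<lbrakk>dim_row C = dim_row B; dim_col C = dim_col B\<rbrakk> \<Longrightarrow> A + (B + (- A + C)) = B + C"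
    "\<lbrakk>dim_row C = dim_row B; dim_col C = dim_col B\<rbrakk> \<Longrightarrow> A + (B + (C + - A)) = B + C"
    "\<lbrakk>dim_row C = dim_row B; dim_col C = dim_col B; dim_row E = dim_row B; dim_col E = dim_col B\<rbrakk>
      \<Longrightarrow> A + (B + (C + (- A + E))) = B + (C + E)"
  using assms by (auto intro!: eq_matI)

lemma mat_units:
  fixes A :: "'a::field mat"
  shows "dim_row A = n \<Longrightarrow> 1\<^sub>m n * A = A" "dim_col A = n \<Longrightarrow> A * 1\<^sub>m n = A"
    "dim_col A = n \<Longrightarrow> A * 0\<^sub>m n k = 0\<^sub>m (dim_row A) k"
    "dim_row A = n \<Longrightarrow> 0\<^sub>m k n * A = 0\<^sub>m k (dim_col A)"
    "\<lbrakk>dim_row A = nr; dim_col A = nc\<rbrakk> \<Longrightarrow> 0\<^sub>m nr nc + A = A"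
    "\<lbrakk>dim_row A = nr; dim_col A = nc\<rbrakk> \<Longrightarrow> A + 0\<^sub>m nr nc = A"
  by (auto intro!: eq_matI)

lemma mat_inverse_left:
  fixes A B C :: "'a::field mat"
  assumes "A * B = 1\<^sub>m n" "dim_col A = dim_row B" "dim_col B = n" "dim_row C = n"
  shows "A * (B * C) = C"
  by (metis assms mat_mult_assoc mat_units(1))

lemmas mat_ring = mat_mult_assoc mat_add_mult mat_mult_add mat_uminus_mult mat_mult_uminus
  mat_add_assoc mat_add_commute mat_add_left_commute mat_minus_eq mat_uminus_add mat_cancel mat_cancel_distant mat_units

lemma four_block_mult:
  fixes A1 :: "'a::field mat"
  assumes "dim_row B1 = dim_row A1" "dim_row D1 = dim_row C1" "dim_col C1 = dim_col A1" "dim_col D1 = dim_col B1"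
    "dim_row B2 = dim_row A2" "dim_row D2 = dim_row C2" "dim_col C2 = dim_col A2" "dim_col D2 = dim_col B2"
    "dim_col A1 = dim_row A2" "dim_col B1 = dim_row C2"
  shows "four_block_mat A1 B1 C1 D1 * four_block_mat A2 B2 C2 D2
    = four_block_mat (A1 * A2 + B1 * C2) (A1 * B2 + B1 * D2) (C1 * A2 + D1 * C2) (C1 * B2 + D1 * D2)"
  using assms by (intro mult_four_block_mat[of _ "dim_row A1" "dim_col A1" _ "dim_col B1" _ "dim_row C1"
        _ _ "dim_col A2" _ "dim_col B2"]) auto

lemma four_block_eqD:
  assumes eq: "four_block_mat A B C D = four_block_mat A' B' C' D'"
    and "A \<in> carrier_mat nr1 nc1" "A' \<in> carrier_mat nr1 nc1"
    "B \<in> carrier_mat nr1 nc2" "B' \<in> carrier_mat nr1 nc2"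
    "C \<in> carrier_mat nr2 nc1" "C' \<in> carrier_mat nr2 nc1"
    "D \<in> carrier_mat nr2 nc2" "D' \<in> carrier_mat nr2 nc2"
  shows "A = A'" "B = B'" "C = C'" "D = D'"
proof -
  have e: "four_block_mat A B C D $$ (i,j) = four_block_mat A' B' C' D' $$ (i,j)" for i j
    using eq by simp
  show "A = A'"
  proof (intro eq_matI)
    fix i j assume "i < dim_row A'" "j < dim_col A'"
    then show "A $$ (i,j) = A' $$ (i,j)" using e[of i j] assms(2-) by simp
  qed (use assms in auto)
  show "B = B'"
  proof (intro eq_matI)
    fix i j assume "i < dim_row B'" "j < dim_col B'"
    then show "B $$ (i,j) = B' $$ (i,j)" using e[of i "nc1 + j"] assms(2-) by simp
  qed (use assms in auto)
  show "C = C'"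
  proof (intro eq_matI)
    fix i j assume "i < dim_row C'" "j < dim_col C'"
    then show "C $$ (i,j) = C' $$ (i,j)" using e[of "nr1 + i" j] assms(2-) by simp
  qed (use assms in auto)
  show "D = D'"
  proof (intro eq_matI)
    fix i j assume "i < dim_row D'" "j < dim_col D'"
    then show "D $$ (i,j) = D' $$ (i,j)" using e[of "nr1 + i" "nc1 + j"] assms(2-) by simp
  qed (use assms in auto)
qed

lemma four_block_cases:
  fixes M :: "'a::field mat"
  assumes "M \<in> carrier_mat (nr1 + nr2) (nc1 + nc2)"
  obtains A B C D where "A \<in> carrier_mat nr1 nc1" "B \<in> carrier_mat nr1 nc2"
    "C \<in> carrier_mat nr2 nc1" "D \<in> carrier_mat nr2 nc2" "M = four_block_mat A B C D"
proof -
  obtain A B C D where s: "split_block M nr1 nc1 = (A, B, C, D)" by (metis prod_cases4)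
  show ?thesis using split_block[OF s, of nr2 nc2] assms that by auto
qed

section \<open>Products of five block factors\<close>

lemma lower_mult:
  fixes A :: "'a::field mat"
  assumes "a \<in> carrier_mat n m" "A \<in> carrier_mat m k" "B \<in> carrier_mat m l" "C \<in> carrier_mat n k" "D \<in> carrier_mat n l"
  shows "four_block_mat (1\<^sub>m m) (0\<^sub>m m n) a (1\<^sub>m n) * four_block_mat A B C D
    = four_block_mat A B (a * A + C) (a * B + D)"
  by (subst mult_four_block_mat[OF _ _ assms(1) _ assms(2-5)]) (use assms in auto)

lemma upper_mult:
  fixes A :: "'a::field mat"
  assumes "a \<in> carrier_mat m n" "A \<in> carrier_mat m k" "B \<in> carrier_mat m l" "C \<in> carrier_mat n k" "D \<in> carrier_mat n l"
  shows "four_block_mat (1\<^sub>m m) a (0\<^sub>m n m) (1\<^sub>m n) * four_block_mat A B C D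
    = four_block_mat (A + a * C) (B + a * D) C D"
  by (subst mult_four_block_mat[OF _ assms(1) _ _ assms(2-5)]) (use assms in auto)

lemma mult_upper:
  fixes A :: "'a::field mat"
  assumes "a \<in> carrier_mat m n" "A \<in> carrier_mat k m" "B \<in> carrier_mat k n" "C \<in> carrier_mat l m" "D \<in> carrier_mat l n"
  shows "four_block_mat A B C D * four_block_mat (1\<^sub>m m) a (0\<^sub>m n m) (1\<^sub>m n)
    = four_block_mat A (A * a + B) C (C * a + D)"
  by (subst mult_four_block_mat[OF assms(2-5) _ assms(1)]) (use assms in auto)

text \<open>The outer lower factors do not touch the upper right block
  \<open>Q = x + z + x * y * z\<close>, which has to vanish. This removes \<open>a\<close> from the
  lower right block, leaving \<open>D = 1 + y * z\<close>, and \<open>e\<close> from the upper left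
  one, leaving \<open>A = 1 + x * y\<close>. Then
  \<open>A * (1 + z * y) = 1 + Q * y\<close>.\<close>

lemma lower_product_diag:
  fixes A D :: "'a::field mat"
  assumes c: "A \<in> carrier_mat m m" "D \<in> carrier_mat n n"
    "a \<in> carrier_mat n m" "x \<in> carrier_mat m n" "y \<in> carrier_mat n m" "z \<in> carrier_mat m n" "e \<in> carrier_mat n m"
    and eq: "four_block_mat A (0\<^sub>m m n) (0\<^sub>m n m) D
      = four_block_mat (1\<^sub>m m) (0\<^sub>m m n) a (1\<^sub>m n) * (four_block_mat (1\<^sub>m m) x (0\<^sub>m n m) (1\<^sub>m n)
        * (four_block_mat (1\<^sub>m m) (0\<^sub>m m n) y (1\<^sub>m n) * (four_block_mat (1\<^sub>m m) z (0\<^sub>m n m) (1\<^sub>m n)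
        * four_block_mat (1\<^sub>m m) (0\<^sub>m m n) e (1\<^sub>m n))))"
  shows "A * (1\<^sub>m m + z * y) = 1\<^sub>m m" "D = 1\<^sub>m n + y * z"
proof -
  note d = c[THEN carrier_matD(1)] c[THEN carrier_matD(2)]
  define R where "R = 1\<^sub>m m + z * e"
  define S where "S = y * R + e"
  define W where "W = y * z + 1\<^sub>m n"
  define Q where "Q = z + x * W"
  have Rc: "R \<in> carrier_mat m m" and Sc: "S \<in> carrier_mat n m" and Wc: "W \<in> carrier_mat n n"
    and Qc: "Q \<in> carrier_mat m n"
    by (rule carrier_matI; simp add: R_def S_def W_def Q_def d)+
  have eq': "four_block_mat A (0\<^sub>m m n) (0\<^sub>m n m) D
    = four_block_mat (R + x * S) Q (a * (R + x * S) + S) (a * Q + W)"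
    unfolding eq using c Rc Sc Wc Qc
    by (simp add: upper_mult[of _ m n _ m _ n] lower_mult[of _ n m _ m _ n] flip: R_def S_def W_def Q_def)
  note b = four_block_eqD[OF eq', of m m n n]
  have b1: "A = R + x * S" and Q: "0\<^sub>m m n = Q" and b3: "D = a * Q + W"
    using b c Qc Rc Sc Wc by auto
  have D: "D = W" using b3 Wc c unfolding Q[symmetric] by simp
  then show "D = 1\<^sub>m n + y * z" by (simp add: W_def d mat_add_commute)
  have "A = 1\<^sub>m m + x * y + Q * e"
    unfolding b1 S_def Q_def W_def R_def by (simp add: d mat_ring)
  then have A: "A = 1\<^sub>m m + x * y" using c by (simp flip: Q)
  have "A * (1\<^sub>m m + z * y) = 1\<^sub>m m + (x + (z + x * (y * z))) * y"
    unfolding A by (simp add: d mat_ring)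
  also have "x + (z + x * (y * z)) = Q"
    unfolding Q_def W_def by (simp add: d mat_ring)
  finally show "A * (1\<^sub>m m + z * y) = 1\<^sub>m m"
    by (simp add: d mat_ring flip: Q)
qed

text \<open>Mirror image of the lower case: here the lower left block has to vanish, and
  \<open>A\<close> and \<open>D\<close> exchange roles.\<close>

lemma upper_product_diag:
  fixes A D :: "'a::field mat"
  assumes c: "A \<in> carrier_mat m m" "D \<in> carrier_mat n n"
    "a \<in> carrier_mat m n" "x \<in> carrier_mat n m" "y \<in> carrier_mat m n" "z \<in> carrier_mat n m" "e \<in> carrier_mat m n"
    and eq: "four_block_mat A (0\<^sub>m m n) (0\<^sub>m n m) D
      = four_block_mat (1\<^sub>m m) a (0\<^sub>m n m) (1\<^sub>m n) * (four_block_mat (1\<^sub>m m) (0\<^sub>m m n) x (1\<^sub>m n)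
        * (four_block_mat (1\<^sub>m m) y (0\<^sub>m n m) (1\<^sub>m n) * (four_block_mat (1\<^sub>m m) (0\<^sub>m m n) z (1\<^sub>m n)
        * four_block_mat (1\<^sub>m m) e (0\<^sub>m n m) (1\<^sub>m n))))"
  shows "D * (1\<^sub>m n + z * y) = 1\<^sub>m n" "A = 1\<^sub>m m + y * z"
proof -
  note d = c[THEN carrier_matD(1)] c[THEN carrier_matD(2)]
  define R where "R = z * e + 1\<^sub>m n"
  define S where "S = e + y * R"
  define W where "W = 1\<^sub>m m + y * z"
  define Q where "Q = x * W + z"
  have Rc: "R \<in> carrier_mat n n" and Sc: "S \<in> carrier_mat m n" and Wc: "W \<in> carrier_mat m m"
    and Qc: "Q \<in> carrier_mat n m"
    by (rule carrier_matI; simp add: R_def S_def W_def Q_def d)+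
  have eq': "four_block_mat A (0\<^sub>m m n) (0\<^sub>m n m) D
    = four_block_mat (W + a * Q) (S + a * (x * S + R)) Q (x * S + R)"
    unfolding eq using c Rc Sc Wc Qc
    by (simp add: upper_mult[of _ m n _ m _ n] lower_mult[of _ n m _ m _ n] flip: R_def S_def W_def Q_def)
  note b = four_block_eqD[OF eq', of m m n n]
  have b1: "D = x * S + R" and Q: "0\<^sub>m n m = Q" and b3: "A = W + a * Q"
    using b c Qc Rc Sc Wc by auto
  have D: "A = W" using b3 Wc c unfolding Q[symmetric] by simp
  then show "A = 1\<^sub>m m + y * z" by (simp add: W_def d mat_add_commute)
  have "D = 1\<^sub>m n + x * y + Q * e"
    unfolding b1 S_def Q_def W_def R_def by (simp add: d mat_ring)
  then have A: "D = 1\<^sub>m n + x * y" using c by (simp flip: Q)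
  have "D * (1\<^sub>m n + z * y) = 1\<^sub>m n + (x + (z + x * (y * z))) * y"
    unfolding A by (simp add: d mat_ring)
  also have "x + (z + x * (y * z)) = Q"
    unfolding Q_def W_def by (simp add: d mat_ring)
  finally show "D * (1\<^sub>m n + z * y) = 1\<^sub>m n"
    by (simp add: d mat_ring flip: Q)
qed

text \<open>Up to the eigenvalue 1, this makes the spectrum of \<open>D\<close> that of the inverse of \<open>A\<close>.\<close>

definition inverse_related :: "'a::field mat \<Rightarrow> 'a mat \<Rightarrow> bool" where
  "inverse_related A D \<longleftrightarrow> (\<exists>y \<in> carrier_mat (dim_row D) (dim_row A). \<exists>z \<in> carrier_mat (dim_row A) (dim_row D).
    A * (1\<^sub>m (dim_row A) + z * y) = 1\<^sub>m (dim_row A) \<and> D = 1\<^sub>m (dim_row D) + y * z)"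

lemma inverse_relatedE:
  fixes A D :: "'a::field mat"
  assumes "inverse_related A D" "A \<in> carrier_mat m m" "D \<in> carrier_mat n n"
  obtains y z where "y \<in> carrier_mat n m" "z \<in> carrier_mat m n" "A * (1\<^sub>m m + z * y) = 1\<^sub>m m"
    "D = 1\<^sub>m n + y * z"
  using assms unfolding inverse_related_def by auto

text \<open>Since \<open>A\<close> inverts \<open>1 + z * y\<close>, the inverse of
  \<open>1 + y * z\<close> is \<open>1 - y * A * z\<close> (Woodbury), and expanding
  \<open>A * (1 + z * y) = 1\<close> gives \<open>A = 1 - A * z * y\<close>. So
  \<open>- (A * z)\<close> and \<open>y\<close> form the new pair. Words starting with either kind
  of factor can thus share one conclusion.\<close>

lemma inverse_related_sym:
  fixes A D :: "'a::field mat"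
  assumes r: "inverse_related A D" and A: "A \<in> carrier_mat m m" and D: "D \<in> carrier_mat n n"
  shows "inverse_related D A"
proof -
  obtain y z where y: "y \<in> carrier_mat n m" and z: "z \<in> carrier_mat m n"
    and e1: "A * (1\<^sub>m m + z * y) = 1\<^sub>m m" and e2: "D = 1\<^sub>m n + y * z"
    by (rule inverse_relatedE[OF r A D])
  note d = carrier_matD[OF A] carrier_matD[OF D] carrier_matD[OF y] carrier_matD[OF z]
  let ?z = "- (A * z)"
  have e1': "(1\<^sub>m m + z * y) * A = 1\<^sub>m m"
    by (rule mat_mult_left_right_inverse[OF A _ e1]) (rule carrier_matI; simp add: d)
  have "D * (1\<^sub>m n + y * ?z) = 1\<^sub>m n + y * (z + - ((1\<^sub>m m + z * y) * A * z))"
    unfolding e2 by (simp add: d mat_ring)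
  also have "\<dots> = 1\<^sub>m n" unfolding e1' by (simp add: d mat_ring)
  finally have 1: "D * (1\<^sub>m n + y * ?z) = 1\<^sub>m n" .
  have "1\<^sub>m m + ?z * y = A * (1\<^sub>m m + z * y) + - (A * (z * y))"
    unfolding e1 by (simp add: d mat_ring)
  also have "\<dots> = A + (A * (z * y) + - (A * (z * y)))" by (simp add: d mat_ring)
  also have "\<dots> = A" by (simp add: d mat_ring)
  finally have 2: "A = 1\<^sub>m m + ?z * y" by simp
  show ?thesis unfolding inverse_related_def
    by (rule bexI[of _ ?z], rule bexI[of _ y]) (use 1 2 d in auto)
qed

text \<open>For \<open>A = 1\<close> the relation gives \<open>z * y = 0\<close>, and this factor
  stands in the middle of the square of \<open>D - 1 = y * z\<close>.\<close>

lemma inverse_related_one: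
  fixes D :: "'a::field mat"
  assumes r: "inverse_related (1\<^sub>m m) D" and D: "D \<in> carrier_mat n n"
  shows "(D - 1\<^sub>m n) * (D - 1\<^sub>m n) = 0\<^sub>m n n"
proof -
  obtain y z where y: "y \<in> carrier_mat n m" and z: "z \<in> carrier_mat m n"
    and e1: "1\<^sub>m m * (1\<^sub>m m + z * y) = 1\<^sub>m m" and e2: "D = 1\<^sub>m n + y * z"
    by (rule inverse_relatedE[OF r _ D]) auto
  note d = carrier_matD[OF D] carrier_matD[OF y] carrier_matD[OF z]
  have "z * y = - 1\<^sub>m m + 1\<^sub>m m * (1\<^sub>m m + z * y)" by (simp add: d mat_ring)
  then have zy: "z * y = 0\<^sub>m m m" unfolding e1 by (simp add: mat_ring)
  have "D - 1\<^sub>m n = y * z" unfolding e2 using d by (intro eq_matI) auto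
  then have "(D - 1\<^sub>m n) * (D - 1\<^sub>m n) = y * (z * y) * z" by (simp add: d mat_ring)
  then show ?thesis unfolding zy by (simp add: d mat_ring)
qed

lemma index_mult_diagonal_left:
  fixes X :: "'a::field mat"
  assumes "X \<in> carrier_mat k k" "Z \<in> carrier_mat k l" "i < k" "j < l"
    and "\<And>p. p < k \<Longrightarrow> p \<noteq> i \<Longrightarrow> X $$ (i,p) = 0"
  shows "(X * Z) $$ (i,j) = X $$ (i,i) * Z $$ (i,j)"
proof -
  have "(X * Z) $$ (i,j) = (\<Sum>p\<in>{0..<k}. X $$ (i,p) * Z $$ (p,j))"
    using assms by (auto simp: scalar_prod_def)
  also have "\<dots> = (\<Sum>p\<in>{i}. X $$ (i,p) * Z $$ (p,j))"
    by (rule sum.mono_neutral_right) (use assms in auto)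
  finally show ?thesis by simp
qed

lemma index_mult_diagonal_right:
  fixes Y :: "'a::field mat"
  assumes "Z \<in> carrier_mat k l" "Y \<in> carrier_mat l l" "i < k" "j < l"
    and "\<And>p. p < l \<Longrightarrow> p \<noteq> j \<Longrightarrow> Y $$ (p,j) = 0"
  shows "(Z * Y) $$ (i,j) = Z $$ (i,j) * Y $$ (j,j)"
proof -
  have "(Z * Y) $$ (i,j) = (\<Sum>p\<in>{0..<l}. Z $$ (i,p) * Y $$ (p,j))"
    using assms by (auto simp: scalar_prod_def)
  also have "\<dots> = (\<Sum>p\<in>{j}. Z $$ (i,p) * Y $$ (p,j))"
    by (rule sum.mono_neutral_right) (use assms in auto)
  finally show ?thesis by simp
qed

text \<open>Multiplying out gives \<open>A z D = z\<close>, which compares diagonal entries wherever \<open>z\<close> does not vanish.\<close>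

lemma inverse_related_diagonal:
  fixes A D :: "'a::field mat"
  assumes r: "inverse_related A D" and A: "A \<in> carrier_mat m m" and D: "D \<in> carrier_mat n n"
    and dA: "\<And>i j. i < m \<Longrightarrow> j < m \<Longrightarrow> i \<noteq> j \<Longrightarrow> A $$ (i,j) = 0"
    and dD: "\<And>i j. i < n \<Longrightarrow> j < n \<Longrightarrow> i \<noteq> j \<Longrightarrow> D $$ (i,j) = 0"
    and j: "j < n" "D $$ (j,j) \<noteq> 1"
  obtains i where "i < m" "A $$ (i,i) * D $$ (j,j) = 1"
proof -
  obtain y z where y: "y \<in> carrier_mat n m" and z: "z \<in> carrier_mat m n"
    and e1: "A * (1\<^sub>m m + z * y) = 1\<^sub>m m" and e2: "D = 1\<^sub>m n + y * z"
    by (rule inverse_relatedE[OF r A D])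
  note d = carrier_matD[OF A] carrier_matD[OF D] carrier_matD[OF y] carrier_matD[OF z]
  have "A * (z * D) = A * (1\<^sub>m m + z * y) * z" unfolding e2 by (simp add: d mat_ring)
  then have AzD: "A * (z * D) = z" unfolding e1 by (simp add: d mat_ring)
  \<comment> \<open>A zero column \<open>j\<close> of \<open>z\<close> would make the entry
    \<open>(j,j)\<close> of \<open>D = 1 + y * z\<close> equal to 1.\<close>
  have "\<exists>i<m. z $$ (i,j) \<noteq> 0"
  proof (rule ccontr)
    assume "\<not> ?thesis"
    then have "(y * z) $$ (j,j) = 0" using j d by (auto simp: scalar_prod_def)
    then show False using j d by (simp add: e2)
  qed
  then obtain i where i: "i < m" "z $$ (i,j) \<noteq> 0" by auto
  have "z $$ (i,j) = (A * (z * D)) $$ (i,j)" by (simp only: AzD)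
  also have "\<dots> = A $$ (i,i) * (z * D) $$ (i,j)"
    by (rule index_mult_diagonal_left[OF A _ i(1) j(1)]) (use z D i dA in auto)
  also have "(z * D) $$ (i,j) = z $$ (i,j) * D $$ (j,j)"
    by (rule index_mult_diagonal_right[OF z D i(1) j(1)]) (use j dD in auto)
  finally show thesis using that[OF i(1)] i(2) by (simp add: field_simps)
qed

section \<open>Words in block factors reduced to alternating products\<close>

text \<open>Neighbouring factors of the same kind multiply within their group, so a word collapses
  to an alternating one, and padding with the unit matrix restores its length. The flag
  \<open>b\<close> says whether the first factor is lower; only two shapes remain for each
  length.\<close>

fun alternating_products :: "bool \<Rightarrow> nat \<Rightarrow> nat \<Rightarrow> nat \<Rightarrow> 'a::field mat set" where
  "alternating_products b m n 0 = {1\<^sub>m (m + n)}"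
| "alternating_products b m n (Suc k) =
    {X * P | X P. X \<in> (if b then BL m n else BU m n) \<and> P \<in> alternating_products (\<not> b) m n k}"

lemma BL_BU_carrier:
  "BL m n \<subseteq> carrier_mat (m + n) (m + n)" "BU m n \<subseteq> carrier_mat (m + n) (m + n)"
  by (auto simp: BL_def BU_def)

lemma BL_BU_one: "1\<^sub>m (m + n) \<in> BL m n" "1\<^sub>m (m + n) \<in> BU m n"
  unfolding BL_def BU_def by (force intro: four_block_one_mat[symmetric])+

lemma BL_mult:
  assumes "X \<in> BL m n" "Y \<in> BL m n"
  shows "X * Y \<in> BL m n"
proof -
  obtain A B where "A \<in> carrier_mat n m" "B \<in> carrier_mat n m"
    "X = four_block_mat (1\<^sub>m m) (0\<^sub>m m n) A (1\<^sub>m n)" "Y = four_block_mat (1\<^sub>m m) (0\<^sub>m m n) B (1\<^sub>m n)"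
    using assms unfolding BL_def by auto
  moreover from this have "X * Y = four_block_mat (1\<^sub>m m) (0\<^sub>m m n) (A + B) (1\<^sub>m n)"
    using lower_mult[of A n m "1\<^sub>m m" m "0\<^sub>m m n" n B "1\<^sub>m n"] by simp
  ultimately show ?thesis unfolding BL_def by (auto intro!: exI[of _ "A + B"])
qed

lemma BU_mult:
  assumes "X \<in> BU m n" "Y \<in> BU m n"
  shows "X * Y \<in> BU m n"
proof -
  obtain A B where "A \<in> carrier_mat m n" "B \<in> carrier_mat m n"
    "X = four_block_mat (1\<^sub>m m) A (0\<^sub>m n m) (1\<^sub>m n)" "Y = four_block_mat (1\<^sub>m m) B (0\<^sub>m n m) (1\<^sub>m n)"
    using assms unfolding BU_def by auto
  moreover from this have "X * Y = four_block_mat (1\<^sub>m m) (B + A) (0\<^sub>m n m) (1\<^sub>m n)"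
    using upper_mult[of A m n "1\<^sub>m m" m B n "0\<^sub>m n m" "1\<^sub>m n"] by simp
  ultimately show ?thesis unfolding BU_def by (auto intro!: exI[of _ "B + A"])
qed

lemma alternating_products_carrier:
  "alternating_products b m n k \<subseteq> carrier_mat (m + n) (m + n)"
proof (induction k arbitrary: b)
  case (Suc k)
  have "X * P \<in> carrier_mat (m + n) (m + n)"
    if "X \<in> (if b then BL m n else BU m n)" "P \<in> alternating_products (\<not> b) m n k" for X P :: "'a mat"
    using that Suc[of "\<not> b"] BL_BU_carrier[of m n] by (intro mult_carrier_mat) (auto split: if_splits)
  then show ?case by auto
qed auto

text \<open>The padding happens at the right end, so the kind of the first factor is kept.\<close>

lemma alternating_products_mono:
  "alternating_products b m n k \<subseteq> alternating_products b m n (Suc k)"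
proof (induction k arbitrary: b)
  case 0
  show ?case using BL_BU_one[of m n] by (auto intro!: exI[of _ "1\<^sub>m (m + n)"])
next
  case (Suc k)
  show ?case using Suc[of "\<not> b"] by (subst (1 2) alternating_products.simps(2)) blast
qed

lemma alternating_products_step:
  assumes X: "X \<in> (if b then BL m n else BU m n)" and P: "P \<in> alternating_products c m n k"
  shows "X * P \<in> alternating_products b m n (Suc k)"
proof (cases "c = b")
  case False
  then have "P \<in> alternating_products (\<not> b) m n k" using P by (cases b; cases c) auto
  then show ?thesis using X unfolding alternating_products.simps by blast
next
  case True
  show ?thesis
  proof (cases k)
    case 0
    then show ?thesis using X P by auto
  next
    case (Suc l)
    then obtain Y Q where Y: "Y \<in> (if b then BL m n else BU m n)"
      and Q: "Q \<in> alternating_products (\<not> b) m n l" and PYQ: "P = Y * Q"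
      using P True by auto
    \<comment> \<open>The first factor of \<open>P\<close> absorbs \<open>X\<close>; the word is
      then one factor short, which padding repairs.\<close>
    have "X * Y \<in> (if b then BL m n else BU m n)"
      using X Y BL_mult BU_mult by (auto split: if_splits)
    then have "X * Y * Q \<in> alternating_products b m n k"
      using Q unfolding Suc alternating_products.simps by blast
    moreover have "X * Y * Q = X * P"
    proof -
      have "X \<in> carrier_mat (m + n) (m + n)" "Y \<in> carrier_mat (m + n) (m + n)"
        "Q \<in> carrier_mat (m + n) (m + n)"
        using X Y BL_BU_carrier[of m n] subsetD[OF alternating_products_carrier Q] by (auto split: if_splits)
      then show ?thesis unfolding PYQ by simp
    qed
    ultimately show ?thesis using alternating_products_mono[of b m n k] by auto
  qed
qed

lemma mat_set_power_alternating:
  "mat_set_power (m + n) (BL m n \<union> BU m n) k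
    \<subseteq> alternating_products True m n k \<union> alternating_products False m n k"
proof -
  have "foldr (*) xs (1\<^sub>m (m + n)) \<in> alternating_products True m n (length xs) \<union> alternating_products False m n (length xs)"
    if "set xs \<subseteq> BL m n \<union> BU m n" for xs :: "'a mat list"
    using that
  proof (induction xs)
    case (Cons X xs)
    then obtain c where P: "foldr (*) xs (1\<^sub>m (m + n)) \<in> alternating_products c m n (length xs)" by auto
    from Cons.prems consider "X \<in> BL m n" | "X \<in> BU m n" by auto
    then show ?case
    proof cases
      case 1
      then show ?thesis using alternating_products_step[OF _ P, of X True] by simp
    next
      case 2
      then show ?thesis using alternating_products_step[OF _ P, of X False] by simp
    qed
  qed simp
  then show ?thesis unfolding mat_set_power_def by blast
qed

lemma diag_five_product_inverse_related:
  fixes A D :: "'a::field mat"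
  assumes A: "A \<in> carrier_mat m m" and D: "D \<in> carrier_mat n n"
    and M: "four_block_mat A (0\<^sub>m m n) (0\<^sub>m n m) D \<in> mat_set_power (m + n) (BL m n \<union> BU m n) 5"
  shows "inverse_related A D"
proof -
  have five: "(5::nat) = Suc (Suc (Suc (Suc (Suc 0))))" by simp
  from M mat_set_power_alternating[of m n 5]
  consider "four_block_mat A (0\<^sub>m m n) (0\<^sub>m n m) D \<in> alternating_products True m n 5"
    | "four_block_mat A (0\<^sub>m m n) (0\<^sub>m n m) D \<in> alternating_products False m n 5" by blast
  then show ?thesis
  proof cases
    case 1
    then obtain a x y z e where c: "a \<in> carrier_mat n m" "x \<in> carrier_mat m n" "y \<in> carrier_mat n m"
      "z \<in> carrier_mat m n" "e \<in> carrier_mat n m"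
      and eq: "four_block_mat A (0\<^sub>m m n) (0\<^sub>m n m) D
      = four_block_mat (1\<^sub>m m) (0\<^sub>m m n) a (1\<^sub>m n) * (four_block_mat (1\<^sub>m m) x (0\<^sub>m n m) (1\<^sub>m n)
        * (four_block_mat (1\<^sub>m m) (0\<^sub>m m n) y (1\<^sub>m n) * (four_block_mat (1\<^sub>m m) z (0\<^sub>m n m) (1\<^sub>m n)
        * (four_block_mat (1\<^sub>m m) (0\<^sub>m m n) e (1\<^sub>m n) * 1\<^sub>m (m + n)))))"
      by (auto simp: five BL_def BU_def)
    have "four_block_mat (1\<^sub>m m) (0\<^sub>m m n) e (1\<^sub>m n) * 1\<^sub>m (m + n) = four_block_mat (1\<^sub>m m) (0\<^sub>m m n) e (1\<^sub>m n)"
      using c by (intro right_mult_one_mat[of _ "m + n"]) auto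
    with eq have "four_block_mat A (0\<^sub>m m n) (0\<^sub>m n m) D
      = four_block_mat (1\<^sub>m m) (0\<^sub>m m n) a (1\<^sub>m n) * (four_block_mat (1\<^sub>m m) x (0\<^sub>m n m) (1\<^sub>m n)
        * (four_block_mat (1\<^sub>m m) (0\<^sub>m m n) y (1\<^sub>m n) * (four_block_mat (1\<^sub>m m) z (0\<^sub>m n m) (1\<^sub>m n)
        * four_block_mat (1\<^sub>m m) (0\<^sub>m m n) e (1\<^sub>m n))))" by simp
    from lower_product_diag[OF A D c this] show ?thesis
      unfolding inverse_related_def using A D c by (intro bexI[of _ y] bexI[of _ z]) auto
  next
    case 2
    then obtain a x y z e where c: "a \<in> carrier_mat m n" "x \<in> carrier_mat n m" "y \<in> carrier_mat m n"
      "z \<in> carrier_mat n m" "e \<in> carrier_mat m n"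
      and eq: "four_block_mat A (0\<^sub>m m n) (0\<^sub>m n m) D
      = four_block_mat (1\<^sub>m m) a (0\<^sub>m n m) (1\<^sub>m n) * (four_block_mat (1\<^sub>m m) (0\<^sub>m m n) x (1\<^sub>m n)
        * (four_block_mat (1\<^sub>m m) y (0\<^sub>m n m) (1\<^sub>m n) * (four_block_mat (1\<^sub>m m) (0\<^sub>m m n) z (1\<^sub>m n)
        * (four_block_mat (1\<^sub>m m) e (0\<^sub>m n m) (1\<^sub>m n) * 1\<^sub>m (m + n)))))"
      by (auto simp: five BL_def BU_def)
    have "four_block_mat (1\<^sub>m m) e (0\<^sub>m n m) (1\<^sub>m n) * 1\<^sub>m (m + n) = four_block_mat (1\<^sub>m m) e (0\<^sub>m n m) (1\<^sub>m n)"
      using c by (intro right_mult_one_mat[of _ "m + n"]) auto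
    with eq have "four_block_mat A (0\<^sub>m m n) (0\<^sub>m n m) D
      = four_block_mat (1\<^sub>m m) a (0\<^sub>m n m) (1\<^sub>m n) * (four_block_mat (1\<^sub>m m) (0\<^sub>m m n) x (1\<^sub>m n)
        * (four_block_mat (1\<^sub>m m) y (0\<^sub>m n m) (1\<^sub>m n) * (four_block_mat (1\<^sub>m m) (0\<^sub>m m n) z (1\<^sub>m n)
        * four_block_mat (1\<^sub>m m) e (0\<^sub>m n m) (1\<^sub>m n))))" by simp
    from upper_product_diag[OF A D c this] have "inverse_related D A"
      unfolding inverse_related_def using A D c by (intro bexI[of _ y] bexI[of _ z]) auto
    then show ?thesis by (rule inverse_related_sym[OF _ D A])
  qed
qed

section \<open>Matrices that are not products of five factors\<close>

text \<open>The matrix has upper left corner [[0, 1], [-1, 1]] and is the unit matrix elsewhere. It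
  is a product of two elementary matrices, and the entry \<open>(0,1)\<close> of the square is -1,
  which is nonzero in every characteristic.\<close>

lemma exists_SL_minus_one_square_nonzero:
  assumes "k \<ge> 2"
  obtains D :: "'a::field mat" where "D \<in> carrier_mat k k" "det D = 1"
    "(D - 1\<^sub>m k) * (D - 1\<^sub>m k) \<noteq> 0\<^sub>m k k"
proof -
  define D :: "'a mat" where "D = addrow 1 0 1 (addrow_mat k (- 1) 1 0)"
  have c: "D \<in> carrier_mat k k" by (simp add: D_def)
  have "det D = det (addrow_mat k (- 1 :: 'a) 1 0)" unfolding D_def
    by (rule det_addrow[where n = k]) (use assms in auto)
  also have "\<dots> = 1" by (rule det_addrow_mat) simp
  finally have det: "det D = 1" .
  have "((D - 1\<^sub>m k) * (D - 1\<^sub>m k)) $$ (0,1) = - 1"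
  proof -
    have "((D - 1\<^sub>m k) * (D - 1\<^sub>m k)) $$ (0,1) = (\<Sum>l\<in>{0..<k}. (D - 1\<^sub>m k) $$ (0,l) * (D - 1\<^sub>m k) $$ (l,1))"
      using assms c by (auto simp: scalar_prod_def)
    also have "\<dots> = (\<Sum>l\<in>{0,1}. (D - 1\<^sub>m k) $$ (0,l) * (D - 1\<^sub>m k) $$ (l,1))"
      by (rule sum.mono_neutral_right) (use assms in \<open>auto simp: D_def\<close>)
    also have "\<dots> = - 1" using assms by (simp add: D_def)
    finally show ?thesis .
  qed
  moreover have "0\<^sub>m k k $$ (0,1) = (0 :: 'a)" using assms by simp
  ultimately have "(D - 1\<^sub>m k) * (D - 1\<^sub>m k) \<noteq> 0\<^sub>m k k" by (metis neg_equal_0_iff_equal zero_neq_one)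
  then show ?thesis using that c det by blast
qed

text \<open>A block of size at least 2 takes \<open>D\<close>, the other one is the unit matrix. If
  \<open>D\<close> is the upper left block, the relation is first turned around by symmetry.\<close>

lemma five_factors_insufficient:
  assumes "m > 0" "n > 0" "m + n > 3"
  shows "\<exists>M \<in> (SL (m + n) :: 'a::field mat set). M \<notin> mat_set_power (m + n) (BL m n \<union> BU m n) 5"
proof (cases "n \<ge> 2")
  case True
  obtain D :: "'a mat" where D: "D \<in> carrier_mat n n" "det D = 1" "(D - 1\<^sub>m n) * (D - 1\<^sub>m n) \<noteq> 0\<^sub>m n n"
    by (rule exists_SL_minus_one_square_nonzero[OF True])
  let ?M = "four_block_mat (1\<^sub>m m) (0\<^sub>m m n) (0\<^sub>m n m) D"
  have "?M \<in> SL (m + n)" using D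
    by (auto simp: SL_def det_four_block_mat_lower_left_zero[of _ m _ n])
  moreover have "?M \<notin> mat_set_power (m + n) (BL m n \<union> BU m n) 5"
    using diag_five_product_inverse_related[OF _ D(1), of "1\<^sub>m m" m] inverse_related_one[OF _ D(1)] D(3) by auto
  ultimately show ?thesis by blast
next
  case False
  then have "m \<ge> 2" using assms by auto
  then obtain D :: "'a mat" where D: "D \<in> carrier_mat m m" "det D = 1" "(D - 1\<^sub>m m) * (D - 1\<^sub>m m) \<noteq> 0\<^sub>m m m"
    by (rule exists_SL_minus_one_square_nonzero)
  let ?M = "four_block_mat D (0\<^sub>m m n) (0\<^sub>m n m) (1\<^sub>m n)"
  have "?M \<in> SL (m + n)" using D
    by (auto simp: SL_def det_four_block_mat_lower_left_zero[of _ m _ n])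
  moreover have "?M \<notin> mat_set_power (m + n) (BL m n \<union> BU m n) 5"
    using diag_five_product_inverse_related[OF D(1), of "1\<^sub>m n" n]
      inverse_related_sym[OF _ D(1), of "1\<^sub>m n" n] inverse_related_one[OF _ D(1)] D(3) by auto
  ultimately show ?thesis by blast
qed

text \<open>Column \<open>j\<close> of \<open>perm_mat N p\<close> has its 1 in row
  \<open>p j\<close>, so conjugation carries the diagonal entry at \<open>j\<close> to position
  \<open>p j\<close>.\<close>

lemma perm_conj_diagonal:
  fixes f :: "nat \<Rightarrow> 'a::field"
  assumes p: "p permutes {0..<N}"
  shows "perm_mat N p * mat N N (\<lambda>(i,j). if i = j then f i else 0) * perm_mat N (inv_into UNIV p)
    = mat N N (\<lambda>(i,j). if i = j then f (inv_into UNIV p i) else 0)" (is "?P * ?F * ?Q = ?G")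
proof -
  have c: "?P \<in> carrier_mat N N" "?F \<in> carrier_mat N N" "?Q \<in> carrier_mat N N"
    by (auto simp: perm_mat_def)
  note pN = permutes_in_image[OF p] permutes_in_image[OF permutes_inv[OF p]]
  have PF: "?P * ?F = mat N N (\<lambda>(i,j). if i = p j then f j else 0)"
  proof (intro eq_matI)
    fix i j assume "i < dim_row (mat N N (\<lambda>(i,j). if i = p j then f j else 0))"
      "j < dim_col (mat N N (\<lambda>(i,j). if i = p j then f j else 0))"
    then have ij: "i < N" "j < N" by auto
    show "(?P * ?F) $$ (i,j) = mat N N (\<lambda>(i,j). if i = p j then f j else 0) $$ (i,j)"
      by (subst index_mult_diagonal_right[OF c(1,2) ij]) (use ij pN in \<open>auto simp: perm_mat_def\<close>)
  qed (auto simp: perm_mat_def)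
  show ?thesis unfolding PF
  proof (intro eq_matI)
    fix i j assume "i < dim_row ?G" "j < dim_col ?G"
    then have ij: "i < N" "j < N" by auto
    let ?q = "inv_into UNIV p"
    have "(mat N N (\<lambda>(i,j). if i = p j then f j else 0) * ?Q) $$ (i,j)
      = (\<Sum>k\<in>{0..<N}. (if i = p k then f k else 0) * (if k = ?q j then 1 else 0))"
      using ij pN(2)[of j] by (auto simp: scalar_prod_def perm_mat_def intro!: sum.cong)
    also have "\<dots> = (\<Sum>k\<in>{?q j}. (if i = p k then f k else 0) * (if k = ?q j then 1 else 0))"
      by (rule sum.mono_neutral_right) (use ij pN(2)[of j] in auto)
    also have "\<dots> = ?G $$ (i,j)" using ij permutes_inverses[OF p] by auto
    finally show "(mat N N (\<lambda>(i,j). if i = p j then f j else 0) * ?Q) $$ (i,j) = ?G $$ (i,j)" .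
  qed (auto simp: perm_mat_def)
qed

text \<open>Only 1 and -1 have square 1, and with 0 they make at most three elements. Infinite
  fields are listed separately because \<open>card\<close> of an infinite set is 0.\<close>

lemma exists_square_not_one:
  assumes "infinite (UNIV :: 'a::field set) \<or> card (UNIV :: 'a::field set) \<ge> 4"
  obtains a :: "'a::field" where "a \<noteq> 0" "a * a \<noteq> 1"
proof -
  have "\<exists>a::'a. a \<notin> {0, 1, - 1}"
  proof (rule ccontr)
    assume "\<not> ?thesis"
    then have U: "(UNIV :: 'a set) = {0, 1, - 1}" by auto
    have "finite {0, 1, - 1 :: 'a}" "card {0, 1, - 1 :: 'a} \<le> 3"
      by (auto intro: card_insert_le_m1)
    then show False using assms unfolding U by auto
  qed
  then obtain a :: 'a where "a \<notin> {0, 1, - 1}" by blast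
  then show ?thesis using that[of a] by (auto simp: square_eq_1_iff)
qed

text \<open>Wherever a permutation puts an entry \<open>a\<close>, the other block would have to
  contain its inverse. As the square of \<open>a\<close> is not 1, that inverse differs from
  \<open>a\<close>, from 1 and from the third entry \<open>inverse (a * a)\<close>. With only
  \<open>a\<close> and its inverse on the diagonal, a permutation could place the two in different
  blocks.\<close>

lemma five_factors_insufficient_permuted:
  assumes card: "infinite (UNIV :: 'a::field set) \<or> card (UNIV :: 'a::field set) \<ge> 4"
    and mn: "m > 0" "n > 0" "m + n > 3"
  shows "\<exists>M \<in> (SL (m + n) :: 'a mat set). \<forall>p. p permutes {0..<m + n} \<longrightarrow>
    perm_mat (m + n) p * M * perm_mat (m + n) (inv_into UNIV p) \<notin> mat_set_power (m + n) (BL m n \<union> BU m n) 5"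
proof -
  obtain a :: 'a where a: "a \<noteq> 0" "a * a \<noteq> 1" by (rule exists_square_not_one[OF card])
  define f :: "nat \<Rightarrow> 'a" where "f i = (if i < 2 then a else if i = 2 then inverse (a * a) else 1)" for i
  have f: "f i * a \<noteq> 1" for i using a by (auto simp: f_def field_simps)
  let ?M = "mat (m + n) (m + n) (\<lambda>(i,j). if i = j then f i else 0)"
  have "det ?M = prod f {0..<m + n}"
    by (subst det_upper_triangular[of _ "m + n"]) (auto simp: prod_list_diag_prod)
  also have "\<dots> = prod f {0,1,2}"
    by (rule prod.mono_neutral_right) (use mn in \<open>auto simp: f_def\<close>)
  also have "\<dots> = 1" using a by (simp add: f_def field_simps)
  finally have "?M \<in> SL (m + n)" by (simp add: SL_def)
  moreover have "perm_mat (m + n) p * ?M * perm_mat (m + n) (inv_into UNIV p)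
      \<notin> mat_set_power (m + n) (BL m n \<union> BU m n) 5" if p: "p permutes {0..<m + n}" for p
  proof
    assume *: "perm_mat (m + n) p * ?M * perm_mat (m + n) (inv_into UNIV p)
      \<in> mat_set_power (m + n) (BL m n \<union> BU m n) 5"
    define g where "g i = f (inv_into UNIV p i)" for i
    define A where "A = mat m m (\<lambda>(i,j). if i = j then g i else 0)"
    define D where "D = mat n n (\<lambda>(i,j). if i = j then g (i + m) else 0)"
    have A: "A \<in> carrier_mat m m" and D: "D \<in> carrier_mat n n" by (auto simp: A_def D_def)
    have "perm_mat (m + n) p * ?M * perm_mat (m + n) (inv_into UNIV p) = four_block_mat A (0\<^sub>m m n) (0\<^sub>m n m) D"
      unfolding perm_conj_diagonal[OF p] by (intro eq_matI) (auto simp: A_def D_def g_def)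
    with * have rel: "inverse_related A D" using diag_five_product_inverse_related[OF A D] by simp
    \<comment> \<open>Conjugation moves the first entry \<open>a\<close> to position
      \<open>p 0\<close>; the block that contains it decides the case.\<close>
    have p0: "p 0 < m + n" using permutes_in_image[OF p, of 0] mn by simp
    have g0: "g (p 0) = a" by (simp add: g_def permutes_inverses[OF p] f_def)
    have g1: "g i * a \<noteq> 1" for i using f by (simp add: g_def)
    have a1: "a \<noteq> 1" using a by auto
    show False
    proof (cases "p 0 < m")
      case True
      obtain i where "i < n" "D $$ (i,i) * A $$ (p 0, p 0) = 1"
        by (rule inverse_related_diagonal[OF inverse_related_sym[OF rel A D] D A, of "p 0"])
          (use True g0 a1 in \<open>auto simp: A_def D_def\<close>)
      then show False using g0 g1[of "i + m"] True by (auto simp: A_def D_def)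
    next
      case False
      then obtain j where j: "p 0 = j + m" "j < n" using p0 by (metis add.commute le_Suc_ex not_less nat_add_left_cancel_less)
      obtain i where "i < m" "A $$ (i,i) * D $$ (j, j) = 1"
        by (rule inverse_related_diagonal[OF rel A D, of j]) (use j g0 a1 in \<open>auto simp: A_def D_def\<close>)
      then show False using g0 g1[of i] j by (auto simp: A_def D_def)
    qed
  qed
  ultimately show ?thesis by blast
qed

section \<open>Reduction to a similarity problem\<close>

lemma det_nonzero_inverse:
  fixes A :: "'a::field mat"
  assumes A: "A \<in> carrier_mat n n" and det: "det A \<noteq> 0"
  obtains B where "B \<in> carrier_mat n n" "A * B = 1\<^sub>m n" "B * A = 1\<^sub>m n"
  using det_non_zero_imp_unit[OF A det, of "()"] unfolding Units_def ring_mat_def by auto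

lemma inverse_det_nonzero:
  fixes A :: "'a::field mat"
  assumes "A \<in> carrier_mat n n" "B \<in> carrier_mat n n" "A * B = 1\<^sub>m n"
  shows "det A \<noteq> 0" "det B \<noteq> 0"
  using det_mult[OF assms(1,2)] assms(3) by auto

lemma det_lower_mult:
  fixes M :: "'a::field mat"
  assumes "a \<in> carrier_mat n m" "M \<in> carrier_mat (m + n) (m + n)"
  shows "det (four_block_mat (1\<^sub>m m) (0\<^sub>m m n) a (1\<^sub>m n) * M) = det M"
  using assms by (subst det_mult[of _ "m + n"]) (auto simp: det_four_block_mat_upper_right_zero[of _ m _ n])

lemma det_upper_mult:
  fixes M :: "'a::field mat"
  assumes "a \<in> carrier_mat m n" "M \<in> carrier_mat (m + n) (m + n)"
  shows "det (four_block_mat (1\<^sub>m m) a (0\<^sub>m n m) (1\<^sub>m n) * M) = det M"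
  using assms by (subst det_mult[of _ "m + n"]) (auto simp: det_four_block_mat_lower_left_zero[of _ m _ n])

text \<open>The upper factor with block \<open>- (A * C')\<close> clears \<open>A\<close>, and
  \<open>?J\<close> exchanges the block rows with one sign. The result is block triangular with
  diagonal blocks \<open>C\<close> and \<open>A * C' * D - B\<close>.\<close>

lemma det_four_block_lower_left_invertible:
  fixes A :: "'a::field mat"
  assumes c: "A \<in> carrier_mat n n" "B \<in> carrier_mat n n" "C \<in> carrier_mat n n" "D \<in> carrier_mat n n" "C' \<in> carrier_mat n n"
    and inv: "C * C' = 1\<^sub>m n" "C' * C = 1\<^sub>m n"
  shows "det (four_block_mat A B C D) = det (C * (A * C' * D - B))"
proof -
  note d = c[THEN carrier_matD(1)] c[THEN carrier_matD(2)]
  let ?J = "four_block_mat (0\<^sub>m n n) (1\<^sub>m n) (- 1\<^sub>m n) (0\<^sub>m n n) :: 'a mat"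
  have Jc: "?J \<in> carrier_mat (n + n) (n + n)" by auto
  \<comment> \<open>Written as three unitriangular factors, the block rotation has determinant 1
    without counting the sign of a permutation.\<close>
  have "?J = four_block_mat (1\<^sub>m n) (1\<^sub>m n) (0\<^sub>m n n) (1\<^sub>m n) * (four_block_mat (1\<^sub>m n) (0\<^sub>m n n) (- 1\<^sub>m n) (1\<^sub>m n)
      * four_block_mat (1\<^sub>m n) (1\<^sub>m n) (0\<^sub>m n n) (1\<^sub>m n))"
    by (subst lower_mult[of _ n n _ n _ n], simp_all, subst upper_mult[of _ n n _ n _ n]) (simp_all add: mat_ring)
  also have "det \<dots> = 1"
    by (subst det_upper_mult) (auto simp: det_lower_mult det_four_block_mat_lower_left_zero[of _ n _ n])
  finally have detJ: "det ?J = 1" .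
  have *: "?J * (four_block_mat (1\<^sub>m n) (- (A * C')) (0\<^sub>m n n) (1\<^sub>m n) * four_block_mat A B C D)
    = four_block_mat C D (0\<^sub>m n n) (A * C' * D - B)"
    using c inv by (subst upper_mult[of _ n n _ n _ n])
      (auto simp: mult_four_block_mat[of _ n n _ n _ n _ _ n _ n] d mat_ring intro!: cong_four_block_mat)
  have "det (four_block_mat A B C D)
    = det (?J * (four_block_mat (1\<^sub>m n) (- (A * C')) (0\<^sub>m n n) (1\<^sub>m n) * four_block_mat A B C D))"
    using c detJ by (subst det_mult[OF Jc]) (auto simp: det_upper_mult)
  also have "\<dots> = det C * det (A * C' * D - B)"
    unfolding * using c by (intro det_four_block_mat_lower_left_zero[of _ n _ n]) auto
  finally show ?thesis using c by (subst det_mult[of _ n]) auto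
qed

text \<open>The two middle factors multiply to the matrix with blocks \<open>A\<close>,
  \<open>b\<close>, \<open>a\<close>, 1. Since \<open>A\<close> is invertible, the outer factors can
  turn \<open>b\<close> and \<open>a\<close> into any \<open>B\<close> and \<open>C\<close>, and
  they preserve the Schur complement \<open>1 - a * A' * b\<close> of \<open>A\<close>; this is the
  condition \<open>schur\<close>.\<close>

lemma four_factor_product:
  fixes A :: "'a::field mat"
  assumes c: "A \<in> carrier_mat n n" "B \<in> carrier_mat n n" "C \<in> carrier_mat n n" "D \<in> carrier_mat n n"
    "a \<in> carrier_mat n n" "b \<in> carrier_mat n n" "A' \<in> carrier_mat n n"
    and A: "A = 1\<^sub>m n + b * a" "A * A' = 1\<^sub>m n" "A' * A = 1\<^sub>m n"
    and schur: "D = C * A' * B + (1\<^sub>m n - a * A' * b)"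
  shows "four_block_mat A B C D
    = four_block_mat (1\<^sub>m n) (0\<^sub>m n n) ((C - a) * A') (1\<^sub>m n) * (four_block_mat (1\<^sub>m n) b (0\<^sub>m n n) (1\<^sub>m n)
      * (four_block_mat (1\<^sub>m n) (0\<^sub>m n n) a (1\<^sub>m n) * four_block_mat (1\<^sub>m n) (A' * (B - b)) (0\<^sub>m n n) (1\<^sub>m n)))"
proof -
  note d = c[THEN carrier_matD(1)] c[THEN carrier_matD(2)]
  let ?d = "A' * (B - b)" and ?c = "(C - a) * A'"
  have cd: "?d \<in> carrier_mat n n" "?c \<in> carrier_mat n n" using c by auto
  have 1: "?d + b * (a * ?d + 1\<^sub>m n) = B"
  proof -
    have "?d + b * (a * ?d + 1\<^sub>m n) = (1\<^sub>m n + b * a) * A' * (B - b) + b" by (simp add: d mat_ring)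
    also have "\<dots> = B" unfolding A(1)[symmetric] A(2) by (simp add: d mat_ring)
    finally show ?thesis .
  qed
  have 2: "?c * A + a = C"
  proof -
    have "?c * A + a = (C - a) * (A' * A) + a" by (simp add: d mat_ring)
    also have "\<dots> = C" unfolding A(3) by (simp add: d mat_ring)
    finally show ?thesis .
  qed
  have 3: "?c * B + (a * ?d + 1\<^sub>m n) = D" unfolding schur by (simp add: d mat_ring)
  show ?thesis using c cd 1 2 3
    by (simp add: lower_mult[of _ n n _ n _ n] upper_mult[of _ n n _ n _ n] A(1)[symmetric])
qed

text \<open>An upper factor can turn the upper left block into any matrix, here \<open>N = 1 + b a\<close>. The last
  equation in the assumptions says that the Schur complement of \<open>N\<close> is the inverse of \<open>1 + a b\<close>, as it
  must be for a product of four factors.\<close>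

lemma five_factors_if_lower_left_invertible:
  fixes A :: "'a::field mat"
  assumes c: "A \<in> carrier_mat n n" "B \<in> carrier_mat n n" "C \<in> carrier_mat n n" "D \<in> carrier_mat n n" "C' \<in> carrier_mat n n"
    and inv: "C * C' = 1\<^sub>m n" "C' * C = 1\<^sub>m n"
    and ab: "a \<in> carrier_mat n n" "b \<in> carrier_mat n n" "det (1\<^sub>m n + b * a) \<noteq> 0"
    and eq: "C * (A * C' * D - B) * (1\<^sub>m n + a * b) = C * (1\<^sub>m n + b * a) * C'"
  shows "\<exists>x \<in> carrier_mat n n. \<exists>y \<in> carrier_mat n n. \<exists>z \<in> carrier_mat n n.
    four_block_mat A B C D = four_block_mat (1\<^sub>m n) x (0\<^sub>m n n) (1\<^sub>m n)
      * (four_block_mat (1\<^sub>m n) (0\<^sub>m n n) y (1\<^sub>m n) * (four_block_mat (1\<^sub>m n) b (0\<^sub>m n n) (1\<^sub>m n)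
      * (four_block_mat (1\<^sub>m n) (0\<^sub>m n n) a (1\<^sub>m n) * four_block_mat (1\<^sub>m n) z (0\<^sub>m n n) (1\<^sub>m n))))"
proof -
  define N where "N = 1\<^sub>m n + b * a"
  define Q where "Q = A * C' * D - B"
  have Nc: "N \<in> carrier_mat n n" and Qc: "Q \<in> carrier_mat n n" using ab c by (auto simp: N_def Q_def)
  obtain N' where N': "N' \<in> carrier_mat n n" "N * N' = 1\<^sub>m n" "N' * N = 1\<^sub>m n"
    using det_nonzero_inverse[OF Nc] ab(3) unfolding N_def by blast
  note c' = c ab(1,2) Nc N'(1) Qc
  note d = c'[THEN carrier_matD(1)] c'[THEN carrier_matD(2)]
  \<comment> \<open>Solution of \<open>A + ?X * C = N\<close>.\<close>
  let ?X = "(N - A) * C'"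
  let ?B = "B + ?X * D"
  define E where "E = 1\<^sub>m n - a * N' * b"
  have Bc: "?B \<in> carrier_mat n n" and Xc: "?X \<in> carrier_mat n n" and Ec: "E \<in> carrier_mat n n"
    using c' by (auto simp: E_def)
  note dE = carrier_matD[OF Ec]
  have B: "?B = N * C' * D - Q"
    unfolding Q_def by (simp add: d mat_ring)
  have Eab: "E * (1\<^sub>m n + a * b) = 1\<^sub>m n"
  proof -
    have "E * (1\<^sub>m n + a * b) = 1\<^sub>m n + a * b - a * (N' * (1\<^sub>m n + b * a)) * b"
      unfolding E_def by (simp add: d mat_ring)
    also have "\<dots> = 1\<^sub>m n" unfolding N_def[symmetric] N'(3) by (simp add: d mat_ring)
    finally show ?thesis .
  qed
  have abE: "(1\<^sub>m n + a * b) * E = 1\<^sub>m n"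
    by (rule mat_mult_left_right_inverse[OF Ec _ Eab], rule carrier_matI) (simp_all add: d)
  \<comment> \<open>By the formula for \<open>?B\<close>, this is the Schur complement of
    \<open>N\<close>. The inserted unit matrices \<open>C' * C\<close> and
    \<open>(1 + a * b) * E\<close> make the left side of \<open>eq\<close> appear.\<close>
  have "C * N' * Q = C * N' * (C' * C) * Q * ((1\<^sub>m n + a * b) * E)"
    unfolding abE inv by (simp add: d mat_units mat_mult_assoc)
  also have "\<dots> = C * N' * C' * (C * Q * (1\<^sub>m n + a * b)) * E"
    by (simp add: d dE mat_mult_assoc)
  also have "\<dots> = C * N' * (C' * C) * N * C' * E"
    unfolding eq[folded Q_def] N_def[symmetric] by (simp add: d dE mat_mult_assoc)
  also have "\<dots> = C * (N' * N) * C' * E"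
    unfolding inv by (simp add: d dE mat_mult_assoc mat_units)
  also have "\<dots> = E"
    unfolding N' by (simp add: d dE mat_units inv)
  finally have CQ: "C * N' * Q = E" .
  have "C * N' * ?B + E = C * (N' * N) * C' * D - C * N' * Q + E"
    unfolding B by (simp add: d dE mat_ring)
  also have "\<dots> = D" unfolding N' CQ by (simp add: d dE mat_ring mat_inverse_left[OF inv(1)])
  finally have schur: "D = C * N' * ?B + (1\<^sub>m n - a * N' * b)" by (simp add: E_def)
  have X: "N + (- ?X) * C = A"
    by (simp add: d mat_ring inv)
  have "four_block_mat (1\<^sub>m n) (- ?X) (0\<^sub>m n n) (1\<^sub>m n) * four_block_mat N ?B C D
    = four_block_mat (N + (- ?X) * C) (?B + (- ?X) * D) C D"
    by (rule upper_mult) (use c' Bc Xc in auto)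
  moreover have "?B + (- ?X) * D = B" by (simp add: d mat_ring)
  ultimately have M: "four_block_mat A B C D = four_block_mat (1\<^sub>m n) (- ?X) (0\<^sub>m n n) (1\<^sub>m n) * four_block_mat N ?B C D"
    using X by (simp only:)
  have f: "four_block_mat N ?B C D = four_block_mat (1\<^sub>m n) (0\<^sub>m n n) ((C - a) * N') (1\<^sub>m n)
      * (four_block_mat (1\<^sub>m n) b (0\<^sub>m n n) (1\<^sub>m n) * (four_block_mat (1\<^sub>m n) (0\<^sub>m n n) a (1\<^sub>m n)
      * four_block_mat (1\<^sub>m n) (N' * (?B - b)) (0\<^sub>m n n) (1\<^sub>m n)))"
    by (rule four_factor_product[OF Nc Bc c(3,4) ab(1,2) N'(1) N_def N'(2,3) schur])
  show ?thesis
  proof (intro bexI)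
    show "four_block_mat A B C D = four_block_mat (1\<^sub>m n) (- ?X) (0\<^sub>m n n) (1\<^sub>m n)
      * (four_block_mat (1\<^sub>m n) (0\<^sub>m n n) ((C - a) * N') (1\<^sub>m n) * (four_block_mat (1\<^sub>m n) b (0\<^sub>m n n) (1\<^sub>m n)
      * (four_block_mat (1\<^sub>m n) (0\<^sub>m n n) a (1\<^sub>m n)
      * four_block_mat (1\<^sub>m n) (N' * (?B - b)) (0\<^sub>m n n) (1\<^sub>m n))))"
      using M f by (simp only:)
  qed (rule carrier_matI; simp add: d)+
qed

lemma rank_one_mult_vec:
  fixes p f w :: "'a::field vec"
  assumes "p \<in> carrier_vec n" "f \<in> carrier_vec n" "w \<in> carrier_vec n"
  shows "mat n n (\<lambda>(i,j). p $ i * f $ j) *\<^sub>v w = (f \<bullet> w) \<cdot>\<^sub>v p"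
  using assms by (intro eq_vecI) (auto simp: scalar_prod_def sum_distrib_left ac_simps)

text \<open>Rank one corrections of \<open>a\<close> extend the injectivity of
  \<open>C + a * A\<close> from vectors supported on the first \<open>k\<close> coordinates to those
  supported on \<open>Suc k\<close>. No generic choice is involved, so the argument works over every
  field.\<close>

lemma exists_invertible_add_mult:
  fixes A C :: "'a::field mat"
  assumes A: "A \<in> carrier_mat n n" and C: "C \<in> carrier_mat n n"
    and ker: "\<And>v. v \<in> carrier_vec n \<Longrightarrow> A *\<^sub>v v = 0\<^sub>v n \<Longrightarrow> C *\<^sub>v v = 0\<^sub>v n \<Longrightarrow> v = 0\<^sub>v n"
  obtains a where "a \<in> carrier_mat n n" "det (C + a * A) \<noteq> 0"
proof -
  define inj where "inj a k \<longleftrightarrow> (\<forall>v \<in> carrier_vec n. (\<forall>i<n. k \<le> i \<longrightarrow> v $ i = 0) \<longrightarrow>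
      (C + a * A) *\<^sub>v v = 0\<^sub>v n \<longrightarrow> v = 0\<^sub>v n)" for a k
  have "\<exists>a \<in> carrier_mat n n. inj a k" if "k \<le> n" for k
    using that
  proof (induction k)
    case 0
    show ?case by (rule bexI[of _ "0\<^sub>m n n"]) (auto simp: inj_def)
  next
    case (Suc k)
    then obtain a where a: "a \<in> carrier_mat n n" and ia: "inj a k" by auto
    show ?case
    proof (cases "inj a (Suc k)")
      case True
      then show ?thesis using a by auto
    next
      case False
      define C1 where "C1 = C + a * A"
      have C1: "C1 \<in> carrier_mat n n" using a A C by (simp add: C1_def)
      from False obtain v where v: "v \<in> carrier_vec n" and vs: "\<And>i. i < n \<Longrightarrow> Suc k \<le> i \<Longrightarrow> v $ i = 0"
        and Cv: "C1 *\<^sub>v v = 0\<^sub>v n" and v0: "v \<noteq> 0\<^sub>v n"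
        unfolding inj_def C1_def by blast
      have inj: "w = 0\<^sub>v n" if "w \<in> carrier_vec n" "\<And>i. i < n \<Longrightarrow> k \<le> i \<Longrightarrow> w $ i = 0" "C1 *\<^sub>v w = 0\<^sub>v n" for w
        using ia that unfolding inj_def C1_def by blast
      have vk: "v $ k \<noteq> 0"
      proof
        assume "v $ k = 0"
        then have "v $ i = 0" if "i < n" "k \<le> i" for i using vs[OF that(1)] that by (cases "i = k") auto
        then show False using inj[OF v _ Cv] v0 by blast
      qed
      have "A *\<^sub>v v \<noteq> 0\<^sub>v n"
      proof
        assume Av: "A *\<^sub>v v = 0\<^sub>v n"
        have "C1 *\<^sub>v v = C *\<^sub>v v + a *\<^sub>v (A *\<^sub>v v)"
          unfolding C1_def using A C a v by (subst add_mult_distrib_mat_vec[of _ n n]) auto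
        moreover have "a *\<^sub>v 0\<^sub>v n = 0\<^sub>v n" using a by (intro eq_vecI) auto
        ultimately have "C *\<^sub>v v = 0\<^sub>v n" using Cv C v unfolding Av by simp
        then show False using ker[OF v Av] v0 by blast
      qed
      then obtain l where l: "l < n" "(A *\<^sub>v v) $ l \<noteq> 0" using A v by (metis carrier_matD(1) dim_mult_mat_vec eq_vecI index_zero_vec)
      \<comment> \<open>The correction must act on the kernel vector \<open>v\<close>, so
        \<open>f\<close> reads a coordinate where \<open>A *\<^sub>v v\<close> does not
        vanish.\<close>
      define f where "f = (unit_vec n l :: 'a vec)"
      have f: "f \<in> carrier_vec n" and fAv: "f \<bullet> (A *\<^sub>v v) \<noteq> 0" using l A v by (auto simp: f_def)
      \<comment> \<open>\<open>H\<close> is \<open>C1\<close> restricted to the first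
        \<open>k\<close> coordinates. Its column \<open>k\<close> is zero, so some nonzero
        \<open>u\<close> annihilates its image, and a \<open>p\<close> with
        \<open>u \<bullet> p\<close> nonzero lies outside that image.\<close>
      define H where "H = mat n n (\<lambda>(i,j). if j < k then C1 $$ (i,j) else 0)"
      have H: "H \<in> carrier_mat n n" by (simp add: H_def)
      have Hw: "C1 *\<^sub>v w = H *\<^sub>v w" if "w \<in> carrier_vec n" "\<And>i. i < n \<Longrightarrow> k \<le> i \<Longrightarrow> w $ i = 0" for w
        using that C1 by (intro eq_vecI) (auto simp: H_def scalar_prod_def intro!: sum.cong)
      have "H *\<^sub>v unit_vec n k = 0\<^sub>v n" "unit_vec n k \<noteq> (0\<^sub>v n :: 'a vec)"
        using Suc.prems by (auto simp: H_def scalar_prod_def unit_vec_def vec_eq_iff intro!: eq_vecI sum.neutral)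
      then have "det H\<^sup>T = 0" using H
        by (subst det_transpose[OF H], subst det_0_iff_vec_prod_zero[OF H]) (metis unit_vec_carrier)
      then obtain u where u: "u \<in> carrier_vec n" "u \<noteq> 0\<^sub>v n" "H\<^sup>T *\<^sub>v u = 0\<^sub>v n"
        using H by (subst (asm) det_0_iff_vec_prod_zero[of _ n]) auto
      then obtain q where q: "q < n" "u $ q \<noteq> 0" by (metis carrier_vecD eq_vecI index_zero_vec)
      define p where "p = (unit_vec n q :: 'a vec)"
      have p: "p \<in> carrier_vec n" and up: "u \<bullet> p \<noteq> 0" using q u by (auto simp: p_def)
      have uC: "u \<bullet> (C1 *\<^sub>v w) = 0" if "w \<in> carrier_vec n" "\<And>i. i < n \<Longrightarrow> k \<le> i \<Longrightarrow> w $ i = 0" for w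
        using transpose_vec_mult_scalar[OF H that(1) u(1)] that u by (simp add: Hw)
      let ?R = "mat n n (\<lambda>(i,j). p $ i * f $ j)"
      have "inj (a + ?R) (Suc k)"
        unfolding inj_def
      proof (intro ballI impI)
        fix b assume b: "b \<in> carrier_vec n" and bs: "\<forall>i<n. Suc k \<le> i \<longrightarrow> b $ i = 0"
          and eq: "(C + (a + ?R) * A) *\<^sub>v b = 0\<^sub>v n"
        let ?s = "f \<bullet> (A *\<^sub>v b)"
        have R: "?R \<in> carrier_mat n n" and RA: "?R * A \<in> carrier_mat n n" using A by auto
        have "C + (a + ?R) * A = C1 + ?R * A"
          unfolding C1_def using A a C by (simp add: add_mult_distrib_mat[of _ n n] mat_add_assoc)
        then have "(C + (a + ?R) * A) *\<^sub>v b = C1 *\<^sub>v b + ?R *\<^sub>v (A *\<^sub>v b)"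
          using add_mult_distrib_mat_vec[OF C1 RA b] assoc_mult_mat_vec[OF R A b] by simp
        also have "?R *\<^sub>v (A *\<^sub>v b) = ?s \<cdot>\<^sub>v p" using A b p f by (intro rank_one_mult_vec) auto
        finally have e: "C1 *\<^sub>v b + ?s \<cdot>\<^sub>v p = 0\<^sub>v n" using eq by simp
        \<comment> \<open>Subtracting \<open>t\<close> times \<open>v\<close> removes coordinate
          \<open>k\<close> from \<open>b\<close>, so the injectivity already known applies to
          \<open>b0\<close>.\<close>
        define t where "t = b $ k / v $ k"
        define b0 where "b0 = b - t \<cdot>\<^sub>v v"
        have b0: "b0 \<in> carrier_vec n" using b v by (simp add: b0_def)
        have b0s: "b0 $ i = 0" if "i < n" "k \<le> i" for i
          using that bs vs vk b v by (cases "i = k") (auto simp: b0_def t_def)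
        have "C1 *\<^sub>v b0 = C1 *\<^sub>v b - t \<cdot>\<^sub>v (C1 *\<^sub>v v)"
          unfolding b0_def using C1 b v by (simp add: mult_minus_distrib_mat_vec[of _ n n] mult_mat_vec[of _ n n])
        then have Cb: "C1 *\<^sub>v b0 = C1 *\<^sub>v b" unfolding Cv using C1 b by (auto intro!: eq_vecI)
        have "u \<bullet> (C1 *\<^sub>v b0) + ?s * (u \<bullet> p) = u \<bullet> (C1 *\<^sub>v b + ?s \<cdot>\<^sub>v p)"
          unfolding Cb using u(1) p C1 b by (subst scalar_prod_add_distrib[of _ n]) auto
        then have s: "?s = 0" using uC[OF b0 b0s] up u(1) unfolding e by simp
        have "C1 *\<^sub>v b0 = 0\<^sub>v n" using e C1 b p unfolding s Cb by (auto intro!: eq_vecI simp: vec_eq_iff)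
        then have "b0 = 0\<^sub>v n" using inj[OF b0 b0s] by blast
        then have bt: "b = t \<cdot>\<^sub>v v" using b v unfolding b0_def by (auto simp: vec_eq_iff)
        have "?s = t * (f \<bullet> (A *\<^sub>v v))" unfolding bt using A v f by (simp add: mult_mat_vec[of _ n n])
        then have "t = 0" using s fAv by simp
        then show "b = 0\<^sub>v n" unfolding bt using v by (auto intro!: eq_vecI)
      qed
      then show ?thesis using a by (intro bexI[of _ "a + ?R"]) auto
    qed
  qed
  from this[of n] obtain a where a: "a \<in> carrier_mat n n" and ia: "inj a n" by auto
  have "det (C + a * A) \<noteq> 0"
    using ia A C a by (subst det_0_iff_vec_prod_zero[of _ n]) (auto simp: inj_def)
  then show thesis using that a by blast
qed

section \<open>Similarity of \<open>E (1 + a b)\<close> and \<open>1 + b a\<close>\<close>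

text \<open>The equation \<open>E (1 + a b) = V (1 + b a) V'\<close> generalises being a commutator, the case of invertible
  \<open>a\<close>. Singular \<open>a\<close> are needed: over the field with two elements a transvection of the plane is not a
  commutator.\<close>

definition balanced :: "nat \<Rightarrow> 'a::field mat \<Rightarrow> bool" where
  "balanced n E \<longleftrightarrow> (\<exists>a b V V'. a \<in> carrier_mat n n \<and> b \<in> carrier_mat n n \<and> V \<in> carrier_mat n n \<and> V' \<in> carrier_mat n n
    \<and> V * V' = 1\<^sub>m n \<and> V' * V = 1\<^sub>m n \<and> det (1\<^sub>m n + b * a) \<noteq> 0 \<and> E * (1\<^sub>m n + a * b) = V * (1\<^sub>m n + b * a) * V')"

text \<open>Passing to \<open>g * a\<close> and \<open>b * g'\<close> conjugates
  \<open>a * b\<close> by \<open>g\<close> and leaves \<open>b * a\<close> unchanged; on the right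
  side the conjugation goes into \<open>V\<close>.\<close>

lemma balanced_similar:
  fixes E :: "'a::field mat"
  assumes b: "balanced n E" and E: "E \<in> carrier_mat n n" and g: "g \<in> carrier_mat n n" "g' \<in> carrier_mat n n"
    and inv: "g * g' = 1\<^sub>m n" "g' * g = 1\<^sub>m n"
  shows "balanced n (g * E * g')"
proof -
  obtain a b V V' where c: "a \<in> carrier_mat n n" "b \<in> carrier_mat n n" "V \<in> carrier_mat n n" "V' \<in> carrier_mat n n"
    and V: "V * V' = 1\<^sub>m n" "V' * V = 1\<^sub>m n" and det: "det (1\<^sub>m n + b * a) \<noteq> 0"
    and eq: "E * (1\<^sub>m n + a * b) = V * (1\<^sub>m n + b * a) * V'"
    using b unfolding balanced_def by blast
  note d = c[THEN carrier_matD(1)] c[THEN carrier_matD(2)] carrier_matD[OF g(1)] carrier_matD[OF g(2)] carrier_matD[OF E]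
  have ba: "b * g' * (g * a) = b * a"
    by (simp add: d mat_mult_assoc mat_inverse_left[OF inv(2)])
  have "g * E * g' * (1\<^sub>m n + g * a * (b * g')) = g * (E * (1\<^sub>m n + a * b)) * g'"
    by (simp add: d mat_ring mat_inverse_left[OF inv(2)])
  also have "\<dots> = (g * V) * (1\<^sub>m n + b * g' * (g * a)) * (V' * g')"
    unfolding eq ba by (simp add: d mat_mult_assoc)
  finally have 1: "g * E * g' * (1\<^sub>m n + g * a * (b * g')) = (g * V) * (1\<^sub>m n + b * g' * (g * a)) * (V' * g')" .
  have 2: "g * V * (V' * g') = 1\<^sub>m n" "V' * g' * (g * V) = 1\<^sub>m n"
    by (simp_all add: d mat_mult_assoc mat_inverse_left[OF V(1)] mat_inverse_left[OF inv(2)] inv V)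
  show ?thesis unfolding balanced_def
    by (rule exI[of _ "g * a"], rule exI[of _ "b * g'"], rule exI[of _ "g * V"], rule exI[of _ "V' * g'"])
      (use 1 2 det ba c g in auto)
qed

definition cyclic_mat :: "nat \<Rightarrow> 'a::field mat" where
  "cyclic_mat n = mat n n (\<lambda>(i,j). if i = Suc j mod n then 1 else 0)"

lemma cyclic_mat_carrier: "cyclic_mat n \<in> carrier_mat n n"
  by (simp add: cyclic_mat_def)

lemma Suc_mod_inj:
  assumes "i < n" "j < n" "Suc i mod n = Suc j mod n"
  shows "i = j"
  using assms by (cases "Suc i = n"; cases "Suc j = n") auto

lemma cyclic_mat_orthogonal:
  "(cyclic_mat n)\<^sup>T * cyclic_mat n = (1\<^sub>m n :: 'a::field mat)"
  "cyclic_mat n * (cyclic_mat n)\<^sup>T = (1\<^sub>m n :: 'a::field mat)"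
proof -
  show 1: "(cyclic_mat n)\<^sup>T * cyclic_mat n = (1\<^sub>m n :: 'a mat)"
  proof (intro eq_matI)
    fix i j assume "i < dim_row (1\<^sub>m n :: 'a mat)" "j < dim_col (1\<^sub>m n :: 'a mat)"
    then have ij: "i < n" "j < n" by auto
    have "((cyclic_mat n)\<^sup>T * cyclic_mat n) $$ (i,j)
      = (\<Sum>k\<in>{0..<n}. (if k = Suc i mod n then 1 else 0) * (if k = Suc j mod n then 1 else (0::'a)))"
      using ij by (auto simp: cyclic_mat_def scalar_prod_def intro!: sum.cong)
    also have "\<dots> = (\<Sum>k\<in>{Suc i mod n}. (if k = Suc i mod n then 1 else 0) * (if k = Suc j mod n then 1 else 0))"
      by (rule sum.mono_neutral_right) (use ij in auto)
    also have "\<dots> = 1\<^sub>m n $$ (i,j)" using ij Suc_mod_inj[OF ij] by auto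
    finally show "((cyclic_mat n)\<^sup>T * cyclic_mat n) $$ (i,j) = (1\<^sub>m n :: 'a mat) $$ (i,j)" .
  qed (auto simp: cyclic_mat_def)
  show "cyclic_mat n * (cyclic_mat n)\<^sup>T = (1\<^sub>m n :: 'a mat)"
    by (rule mat_mult_left_right_inverse[OF _ cyclic_mat_carrier 1]) (simp add: cyclic_mat_def)
qed

text \<open>Clock and shift matrices: conjugating the diagonal matrix of the powers of
  \<open>c\<close> by the cyclic matrix multiplies it by \<open>c\<close>. The witnesses are
  \<open>a = Y - 1\<close> and \<open>b = 1\<close>.\<close>

lemma balanced_scalar:
  fixes c :: "'a::field"
  assumes n: "n > 0" and c: "c ^ n = 1"
  shows "balanced n (c \<cdot>\<^sub>m 1\<^sub>m n)"
proof -
  have c0: "c \<noteq> 0" using n c by (auto simp: zero_power)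
  define Y where "Y = mat n n (\<lambda>(i,j). if i = j then c ^ i else 0)"
  let ?C = "cyclic_mat n :: 'a mat"
  have Y: "Y \<in> carrier_mat n n" by (simp add: Y_def)
  have C: "?C \<in> carrier_mat n n" by (rule cyclic_mat_carrier)
  have one: "1\<^sub>m n + 1\<^sub>m n * (Y - 1\<^sub>m n) = Y" "1\<^sub>m n + (Y - 1\<^sub>m n) * 1\<^sub>m n = Y"
    using Y by (auto intro!: eq_matI)
  have "det Y = prod (\<lambda>i. c ^ i) {0..<n}"
    by (subst det_upper_triangular[of _ n]) (auto simp: Y_def prod_list_diag_prod)
  then have det: "det Y \<noteq> 0" using c0 by simp
  have YC: "Y * ?C = c \<cdot>\<^sub>m (?C * Y)"
  proof (intro eq_matI)
    fix i j assume "i < dim_row (c \<cdot>\<^sub>m (?C * Y))" "j < dim_col (c \<cdot>\<^sub>m (?C * Y))"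
    then have ij: "i < n" "j < n" by (auto simp: cyclic_mat_def Y_def)
    have "(Y * ?C) $$ (i,j) = Y $$ (i,i) * ?C $$ (i,j)"
      by (rule index_mult_diagonal_left[OF Y C ij]) (use ij in \<open>auto simp: Y_def\<close>)
    moreover have "(?C * Y) $$ (i,j) = ?C $$ (i,j) * Y $$ (j,j)"
      by (rule index_mult_diagonal_right[OF C Y ij]) (use ij in \<open>auto simp: Y_def\<close>)
    \<comment> \<open>At the wrap-around, \<open>c ^ n = 1\<close> enters.\<close>
    moreover have "c ^ (Suc j mod n) = c * c ^ j" using ij c by (cases "Suc j = n") auto
    ultimately show "(Y * ?C) $$ (i,j) = (c \<cdot>\<^sub>m (?C * Y)) $$ (i,j)"
      using ij C Y by (auto simp: cyclic_mat_def Y_def)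
  qed (auto simp: cyclic_mat_def Y_def)
  have "c \<cdot>\<^sub>m 1\<^sub>m n * Y = ?C\<^sup>T * (c \<cdot>\<^sub>m (?C * Y))"
    using Y C mat_inverse_left[OF cyclic_mat_orthogonal(1), of n Y]
    by (simp add: mult_smult_distrib[of _ n n _ n] mult_smult_assoc_mat[of _ n n _ n])
  also have "\<dots> = ?C\<^sup>T * Y * ?C"
    unfolding YC[symmetric] using Y C by simp
  finally have eq: "c \<cdot>\<^sub>m 1\<^sub>m n * Y = ?C\<^sup>T * Y * ?C" .
  show ?thesis unfolding balanced_def
  proof (intro exI conjI)
    show "c \<cdot>\<^sub>m 1\<^sub>m n * (1\<^sub>m n + (Y - 1\<^sub>m n) * 1\<^sub>m n) = ?C\<^sup>T * (1\<^sub>m n + 1\<^sub>m n * (Y - 1\<^sub>m n)) * ?C"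
      "det (1\<^sub>m n + 1\<^sub>m n * (Y - 1\<^sub>m n)) \<noteq> 0"
      unfolding one by (fact eq det)+
  qed (use Y C in \<open>auto simp: cyclic_mat_orthogonal\<close>)
qed

text \<open>\<open>?b\<close> is the projection that discards the first coordinate:
  \<open>?a * ?b\<close> sees only the last columns of \<open>?a\<close>, and \<open>?b * ?a\<close>
  only its last rows. So \<open>1 + ?a * ?b\<close> can be block upper, where it clears
  \<open>r\<close>, while \<open>1 + ?b * ?a\<close> is block lower and supplies \<open>s\<close>.
  There remains \<open>R * X\<close> to compare with \<open>W * X * W'\<close>.\<close>

lemma balanced_block:
  fixes R :: "'a::field mat"
  assumes c: "r \<in> carrier_mat 1 m" "s \<in> carrier_mat m 1" "R \<in> carrier_mat m m"
    "X \<in> carrier_mat m m" "W \<in> carrier_mat m m" "W' \<in> carrier_mat m m"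
    and W: "W * W' = 1\<^sub>m m" "W' * W = 1\<^sub>m m" and det: "det X \<noteq> 0" and eq: "R * X = W * X * W'"
  shows "balanced (1 + m) (four_block_mat (1\<^sub>m 1) r s (R + s * r))"
proof -
  note d = c[THEN carrier_matD(1)] c[THEN carrier_matD(2)]
  let ?a = "four_block_mat (0\<^sub>m 1 1) (- (r * X)) (W' * s) (X - 1\<^sub>m m)"
  let ?b = "four_block_mat (0\<^sub>m 1 1) (0\<^sub>m 1 m) (0\<^sub>m m 1) (1\<^sub>m m)"
  let ?V = "four_block_mat (1\<^sub>m 1) (0\<^sub>m 1 m) (0\<^sub>m m 1) W"
  let ?V' = "four_block_mat (1\<^sub>m 1) (0\<^sub>m 1 m) (0\<^sub>m m 1) W'"
  let ?K = "four_block_mat (1\<^sub>m 1) (0\<^sub>m 1 m) (W' * s) X"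
  have one: "1\<^sub>m (1 + m) = four_block_mat (1\<^sub>m 1) (0\<^sub>m 1 m) (0\<^sub>m m 1) (1\<^sub>m m)"
    by (rule four_block_one_mat[symmetric])
  have ab: "1\<^sub>m (1 + m) + ?a * ?b = four_block_mat (1\<^sub>m 1) (- (r * X)) (0\<^sub>m m 1) X"
  proof -
    have *: "?a * ?b = four_block_mat (0\<^sub>m 1 1) (- (r * X)) (0\<^sub>m m 1) (X - 1\<^sub>m m)"
      using c by (simp add: four_block_mult d mat_ring)
    show ?thesis unfolding * one
      using c by (subst add_four_block_mat[of _ 1 1 _ m _ m]) (auto simp: d mat_ring)
  qed
  have ba: "1\<^sub>m (1 + m) + ?b * ?a = ?K"
  proof -
    have *: "?b * ?a = four_block_mat (0\<^sub>m 1 1) (0\<^sub>m 1 m) (W' * s) (X - 1\<^sub>m m)"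
      using c by (simp add: four_block_mult d mat_ring)
    show ?thesis unfolding * one
      using c by (subst add_four_block_mat[of _ 1 1 _ m _ m]) (auto simp: d mat_ring)
  qed
  have V: "?V * ?V' = 1\<^sub>m (1 + m)" "?V' * ?V = 1\<^sub>m (1 + m)"
    unfolding one using c by (simp_all add: four_block_mult d mat_ring W)
  have "det ?K = det (1\<^sub>m 1) * det X"
    by (rule det_four_block_mat_upper_right_zero[of _ 1 _ m]) (use c in auto)
  then have dK: "det ?K \<noteq> 0" using det by simp
  have "?V * ?K * ?V' = four_block_mat (1\<^sub>m 1) (0\<^sub>m 1 m) s (W * X * W')"
    using c by (simp add: four_block_mult d mat_ring mat_inverse_left[OF W(1)])
  moreover have "four_block_mat (1\<^sub>m 1) r s (R + s * r) * four_block_mat (1\<^sub>m 1) (- (r * X)) (0\<^sub>m m 1) X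
    = four_block_mat (1\<^sub>m 1) (0\<^sub>m 1 m) s (R * X)"
    using c by (simp add: four_block_mult d mat_ring)
  ultimately have e: "four_block_mat (1\<^sub>m 1) r s (R + s * r) * (1\<^sub>m (1 + m) + ?a * ?b) = ?V * (1\<^sub>m (1 + m) + ?b * ?a) * ?V'"
    unfolding ab ba eq by simp
  have cs: "?a \<in> carrier_mat (1 + m) (1 + m)" "?b \<in> carrier_mat (1 + m) (1 + m)"
    "?V \<in> carrier_mat (1 + m) (1 + m)" "?V' \<in> carrier_mat (1 + m) (1 + m)"
    by (rule carrier_matI; simp add: d)+
  show ?thesis unfolding balanced_def
    by (intro exI[of _ ?a] exI[of _ ?b] exI[of _ ?V] exI[of _ ?V'] conjI cs V e) (simp only: ba dK not_False_eq_True)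
qed

text \<open>Conjugating by an upper factor whose row annihilates \<open>s\<close> keeps \<open>s\<close> and multiplies the Schur
  complement \<open>R\<close> by a transvection.\<close>

lemma balanced_block_transvection:
  fixes R :: "'a::field mat"
  assumes c: "r \<in> carrier_mat 1 m" "s \<in> carrier_mat m 1" "R \<in> carrier_mat m m" "w \<in> carrier_mat 1 m"
    "X \<in> carrier_mat m m" "W \<in> carrier_mat m m" "W' \<in> carrier_mat m m"
    and W: "W * W' = 1\<^sub>m m" "W' * W = 1\<^sub>m m" and det: "det X \<noteq> 0"
    and ws: "w * s = 0\<^sub>m 1 1" and eq: "(1\<^sub>m m + s * w) * R * X = W * X * W'"
  shows "balanced (1 + m) (four_block_mat (1\<^sub>m 1) r s (R + s * r))"
proof -
  note d = c[THEN carrier_matD(1)] c[THEN carrier_matD(2)]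
  \<comment> \<open>Conjugation by \<open>?g\<close> changes the upper right block to
    \<open>?r + w * R - w\<close>, which has to be \<open>r\<close>.\<close>
  let ?r = "r - w * R + w"
  let ?R = "(1\<^sub>m m + s * w) * R"
  let ?S = "four_block_mat (1\<^sub>m 1) ?r s (?R + s * ?r)"
  let ?g = "four_block_mat (1\<^sub>m 1) w (0\<^sub>m m 1) (1\<^sub>m m)" and ?g' = "four_block_mat (1\<^sub>m 1) (- w) (0\<^sub>m m 1) (1\<^sub>m m)"
  have cs: "?g \<in> carrier_mat (1 + m) (1 + m)" "?g' \<in> carrier_mat (1 + m) (1 + m)" "?S \<in> carrier_mat (1 + m) (1 + m)"
    by (rule carrier_matI; simp add: d)+
  have b: "balanced (1 + m) ?S"
    by (rule balanced_block[OF _ c(2) _ c(5-7) W det eq]; rule carrier_matI; simp add: d)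
  have wsl: "w * (s * Z) = 0\<^sub>m 1 m" if "Z \<in> carrier_mat 1 m" for Z
  proof -
    have "w * (s * Z) = w * s * Z" using that by (simp add: d mat_mult_assoc)
    then show ?thesis unfolding ws using that by simp
  qed
  have wS: "w * (?R + s * ?r) = w * R"
    using c by (simp add: d mat_ring wsl)
  have inv: "?g * ?g' = 1\<^sub>m (1 + m)" "?g' * ?g = 1\<^sub>m (1 + m)"
    unfolding four_block_one_mat[of 1 m, symmetric] using c by (simp_all add: four_block_mult d mat_ring)
  have "?g * ?S = four_block_mat (1\<^sub>m 1) (?r + w * R) s (?R + s * ?r)"
    by (subst upper_mult[of _ 1 m _ 1 _ m]) (use c ws wS in auto)
  also have "\<dots> * ?g' = four_block_mat (1\<^sub>m 1) (1\<^sub>m 1 * (- w) + (?r + w * R)) s (s * (- w) + (?R + s * ?r))"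
    by (subst mult_upper[of _ 1 m]) (use c in auto)
  also have "\<dots> = four_block_mat (1\<^sub>m 1) r s (R + s * r)"
    by (rule cong_four_block_mat) (simp_all add: d mat_ring)
  finally show ?thesis using balanced_similar[OF b cs(3,1,2) inv] by simp
qed

section \<open>Normal forms under similarity\<close>

definition inverse_pair :: "nat \<Rightarrow> 'a::field mat \<Rightarrow> 'a mat \<Rightarrow> bool" where
  "inverse_pair n g g' \<longleftrightarrow> g \<in> carrier_mat n n \<and> g' \<in> carrier_mat n n \<and> g * g' = 1\<^sub>m n \<and> g' * g = 1\<^sub>m n"

lemma inverse_pair_one: "inverse_pair n (1\<^sub>m n) (1\<^sub>m n)"
  by (simp add: inverse_pair_def)

lemma inverse_pair_mult:
  fixes g h :: "'a::field mat"
  assumes "inverse_pair n g g'" "inverse_pair n h h'"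
  shows "inverse_pair n (h * g) (g' * h')"
proof -
  have c: "g \<in> carrier_mat n n" "g' \<in> carrier_mat n n" "h \<in> carrier_mat n n" "h' \<in> carrier_mat n n"
    and inv: "g * g' = 1\<^sub>m n" "g' * g = 1\<^sub>m n" "h * h' = 1\<^sub>m n" "h' * h = 1\<^sub>m n"
    using assms by (auto simp: inverse_pair_def)
  note d = c[THEN carrier_matD(1)] c[THEN carrier_matD(2)]
  show ?thesis unfolding inverse_pair_def
    using c by (auto simp: d mat_mult_assoc mat_inverse_left[OF inv(1)] mat_inverse_left[OF inv(4)] inv simp del: assoc_mult_mat)
qed

lemma inverse_pair_upper:
  fixes h :: "'a::field mat"
  assumes "h \<in> carrier_mat m n"
  shows "inverse_pair (m + n) (four_block_mat (1\<^sub>m m) h (0\<^sub>m n m) (1\<^sub>m n)) (four_block_mat (1\<^sub>m m) (- h) (0\<^sub>m n m) (1\<^sub>m n))"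
  using assms unfolding inverse_pair_def
  by (auto simp: upper_mult[of _ m n _ m _ n] mat_cancel mat_units)

lemma inverse_pair_lower:
  fixes h :: "'a::field mat"
  assumes "h \<in> carrier_mat n m"
  shows "inverse_pair (m + n) (four_block_mat (1\<^sub>m m) (0\<^sub>m m n) h (1\<^sub>m n)) (four_block_mat (1\<^sub>m m) (0\<^sub>m m n) (- h) (1\<^sub>m n))"
  using assms unfolding inverse_pair_def
  by (auto simp: lower_mult[of _ n m _ m _ n] mat_cancel mat_units)

lemma inverse_pair_diag:
  fixes g h :: "'a::field mat"
  assumes "inverse_pair m g g'" "inverse_pair n h h'"
  shows "inverse_pair (m + n) (four_block_mat g (0\<^sub>m m n) (0\<^sub>m n m) h) (four_block_mat g' (0\<^sub>m m n) (0\<^sub>m n m) h')"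
  using assms unfolding inverse_pair_def
  by (auto simp: mult_four_block_mat[of _ m m _ n _ n _ _ m _ n])

text \<open>A column matrix and not a vector, so that \<open>w * s\<close>, \<open>s * w\<close> and
  block decompositions remain matrix products.\<close>

definition unit_col :: "nat \<Rightarrow> 'a::field mat" where
  "unit_col n = mat n 1 (\<lambda>(i,_). if i = 0 then 1 else 0)"

lemma unit_col_carrier: "unit_col n \<in> carrier_mat n 1"
  by (simp add: unit_col_def)

lemma unit_col_block:
  "unit_col (1 + m) = four_block_mat (1\<^sub>m 1) (0\<^sub>m 1 0) (0\<^sub>m m 1) (0\<^sub>m m 0)"
  by (intro eq_matI) (auto simp: unit_col_def)

lemma unit_col_nonzero: "n > 0 \<Longrightarrow> unit_col n \<noteq> (0\<^sub>m n 1 :: 'a::field mat)"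
proof
  assume "n > 0" "unit_col n = (0\<^sub>m n 1 :: 'a mat)"
  then have "unit_col n $$ (0,0) = (0::'a)" by simp
  then show False using \<open>n > 0\<close> by (simp add: unit_col_def)
qed

lemma single_mult:
  fixes x y :: "'a::field"
  shows "mat 1 1 (\<lambda>_. x) * mat 1 1 (\<lambda>_. y) = mat 1 1 (\<lambda>_. x * y)" "1\<^sub>m 1 = mat 1 1 (\<lambda>_. 1 :: 'a)"
  by (auto intro!: eq_matI simp: scalar_prod_def)

lemma single_cases:
  fixes A :: "'a::field mat"
  assumes "A \<in> carrier_mat 1 1"
  shows "A = mat 1 1 (\<lambda>_. A $$ (0,0))"
  using assms by (intro eq_matI) auto

lemma row_mult_surj:
  fixes t :: "'a::field mat"
  assumes t: "t \<in> carrier_mat m 1" "t \<noteq> 0\<^sub>m m 1"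
  obtains h where "h \<in> carrier_mat 1 m" "h * t = mat 1 1 (\<lambda>_. x)"
proof -
  have "\<exists>i<m. t $$ (i,0) \<noteq> 0"
  proof (rule ccontr)
    assume "\<not> ?thesis"
    then have "t = 0\<^sub>m m 1" using t by (intro eq_matI) auto
    then show False using t by simp
  qed
  then obtain i where i: "i < m" "t $$ (i,0) \<noteq> 0" by blast
  define h where "h = mat 1 m (\<lambda>(_,j). if j = i then x / t $$ (i,0) else 0)"
  have "(h * t) $$ (0,0) = (\<Sum>j\<in>{0..<m}. (if j = i then x / t $$ (i,0) else 0) * t $$ (j,0))"
    using t by (auto simp: h_def scalar_prod_def intro!: sum.cong)
  also have "\<dots> = (\<Sum>j\<in>{i}. (if j = i then x / t $$ (i,0) else 0) * t $$ (j,0))"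
    by (rule sum.mono_neutral_right) (use i in auto)
  also have "\<dots> = x" using i by simp
  finally have "h * t = mat 1 1 (\<lambda>_. x)" using t by (intro eq_matI) (auto simp: h_def)
  then show thesis using that[of h] by (simp add: h_def)
qed

text \<open>If an entry below the first is nonzero, one factor makes the first entry 1 and another
  clears the rest; otherwise the first entry is scaled.\<close>

lemma col_to_unit_col:
  fixes s :: "'a::field mat"
  assumes s: "s \<in> carrier_mat n 1" "s \<noteq> 0\<^sub>m n 1"
  obtains g g' where "inverse_pair n g g'" "g * s = unit_col n"
proof -
  have "n \<noteq> 0"
  proof
    assume "n = 0"
    then have "s = 0\<^sub>m n 1" using s by (intro eq_matI) auto
    then show False using s by simp
  qed
  then obtain m where n: "n = 1 + m" by (metis add.commute Suc_eq_plus1 not0_implies_Suc)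
  \<comment> \<open>The second block column has width 0; this makes the block product rules
    applicable to a column.\<close>
  obtain A B C D where c: "A \<in> carrier_mat 1 1" "B \<in> carrier_mat 1 0" "C \<in> carrier_mat m 1" "D \<in> carrier_mat m 0"
    and sb: "s = four_block_mat A B C D"
    by (rule four_block_cases[of s 1 m 1 0]) (use s n in auto)
  note d = c[THEN carrier_matD(1)] c[THEN carrier_matD(2)]
  have BD: "B = 0\<^sub>m 1 0" "D = 0\<^sub>m m 0" using c by (auto intro!: eq_matI)
  show thesis
  proof (cases "C = 0\<^sub>m m 1")
    case True
    define x where "x = A $$ (0,0)"
    have A: "A = mat 1 1 (\<lambda>_. x)" using single_cases[OF c(1)] by (simp add: x_def)
    have x: "x \<noteq> 0"
    proof
      assume "x = 0"
      then have "A = 0\<^sub>m 1 1" unfolding A by (intro eq_matI) auto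
      then have "s = 0\<^sub>m n 1" unfolding sb True BD n by (intro eq_matI) auto
      then show False using s by simp
    qed
    have inv: "inverse_pair 1 (mat 1 1 (\<lambda>_. 1 / x)) (mat 1 1 (\<lambda>_. x))"
      using x unfolding inverse_pair_def single_mult by simp
    have "four_block_mat (mat 1 1 (\<lambda>_. 1 / x)) (0\<^sub>m 1 m) (0\<^sub>m m 1) (1\<^sub>m m) * s = unit_col n"
      unfolding sb n unit_col_block True BD A
      by (subst mult_four_block_mat[of _ 1 1 _ m _ m _ _ 1 _ 0])
        (use x single_mult(1)[of "1 / x" x] in \<open>auto simp: mat_units single_mult(2) simp del: index_mult_mat intro!: cong_four_block_mat\<close>)
    then show thesis using that inverse_pair_diag[OF inv inverse_pair_one[of m]] unfolding n by blast
  next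
    case False
    obtain h where h: "h \<in> carrier_mat 1 m" "h * C = mat 1 1 (\<lambda>_. 1 - A $$ (0,0))"
      by (rule row_mult_surj[OF c(3) False])
    have A1: "A + h * C = 1\<^sub>m 1" unfolding h(2) using c by (intro eq_matI) auto
    let ?u = "four_block_mat (1\<^sub>m 1) h (0\<^sub>m m 1) (1\<^sub>m m)"
    let ?l = "four_block_mat (1\<^sub>m 1) (0\<^sub>m 1 m) (- C) (1\<^sub>m m)"
    have us: "?u * s = four_block_mat (1\<^sub>m 1) B C D"
      unfolding sb using c h(1)
      by (subst upper_mult[of _ 1 m _ 1 _ 0]) (auto simp: A1 BD mat_units intro!: cong_four_block_mat)
    have "?l * (?u * s) = unit_col n"
      unfolding us n unit_col_block using c
      by (subst lower_mult[of _ m 1 _ 1 _ 0]) (auto simp: BD mat_units mat_cancel intro!: cong_four_block_mat)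
    moreover have "?l * (?u * s) = (?l * ?u) * s"
      by (rule assoc_mult_mat[symmetric, of _ "1 + m" "1 + m" _ "1 + m" _ 1]) (use s n c h in auto)
    ultimately have "(?l * ?u) * s = unit_col n" by simp
    moreover have "inverse_pair n (?l * ?u) (four_block_mat (1\<^sub>m 1) (- h) (0\<^sub>m m 1) (1\<^sub>m m)
        * four_block_mat (1\<^sub>m 1) (0\<^sub>m 1 m) C (1\<^sub>m m))"
      unfolding n using inverse_pair_mult[OF inverse_pair_upper[OF h(1)] inverse_pair_lower[of "- C" m 1]] c
      by (simp add: mat_cancel)
    ultimately show thesis using that by blast
  qed
qed

text \<open>With \<open>h * t = 1 - \<alpha>\<close> the left factor makes the corner 1, and the
  right factor changes only the last columns.\<close>

lemma conjugate_corner: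
  fixes D :: "'a::field mat"
  assumes c: "\<alpha> \<in> carrier_mat 1 1" "r \<in> carrier_mat 1 m" "t \<in> carrier_mat m 1" "D \<in> carrier_mat m m"
    and t: "t \<noteq> 0\<^sub>m m 1"
  obtains h r' D' where "h \<in> carrier_mat 1 m" "r' \<in> carrier_mat 1 m" "D' \<in> carrier_mat m m"
    "four_block_mat (1\<^sub>m 1) h (0\<^sub>m m 1) (1\<^sub>m m) * four_block_mat \<alpha> r t D
      * four_block_mat (1\<^sub>m 1) (- h) (0\<^sub>m m 1) (1\<^sub>m m) = four_block_mat (1\<^sub>m 1) r' t D'"
proof -
  obtain h where h: "h \<in> carrier_mat 1 m" "h * t = mat 1 1 (\<lambda>_. 1 - \<alpha> $$ (0,0))"
    by (rule row_mult_surj[OF c(3) t])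
  have A1: "\<alpha> + h * t = 1\<^sub>m 1" unfolding h(2) using c by (intro eq_matI) auto
  have "four_block_mat (1\<^sub>m 1) h (0\<^sub>m m 1) (1\<^sub>m m) * four_block_mat \<alpha> r t D = four_block_mat (1\<^sub>m 1) (r + h * D) t D"
    using c h(1) by (subst upper_mult[of _ 1 m _ 1 _ m]) (auto simp: A1)
  also have "\<dots> * four_block_mat (1\<^sub>m 1) (- h) (0\<^sub>m m 1) (1\<^sub>m m)
    = four_block_mat (1\<^sub>m 1) (1\<^sub>m 1 * (- h) + (r + h * D)) t (t * (- h) + D)"
    using c h(1) by (subst mult_upper[of _ 1 m]) auto
  finally show thesis
    by (rule that[rotated 3]) (use c h in auto)
qed

text \<open>Unit vectors and sums of two of them are enough: if all were eigenvectors, the former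
  would make \<open>E\<close> diagonal and the latter its diagonal entries equal.\<close>

lemma nonscalar_non_eigenvector:
  fixes E :: "'a::field mat"
  assumes E: "E \<in> carrier_mat n n" and ns: "\<And>c. E \<noteq> c \<cdot>\<^sub>m 1\<^sub>m n"
  obtains v where "v \<in> carrier_mat n 1" "\<And>x. E * v \<noteq> x \<cdot>\<^sub>m v"
proof -
  define v where "v i j = mat n 1 (\<lambda>(k,_). if k = i \<or> k = j then 1 else (0::'a))" for i j
  have v: "v i j \<in> carrier_mat n 1" for i j by (simp add: v_def)
  have Ev: "(E * v i j) $$ (k,0) = (if i = j then E $$ (k,i) else E $$ (k,i) + E $$ (k,j))"
    if "i < n" "j < n" "k < n" for i j k
  proof -
    have "(E * v i j) $$ (k,0) = (\<Sum>l\<in>{0..<n}. E $$ (k,l) * (if l = i \<or> l = j then 1 else 0))"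
      using that E by (auto simp: v_def scalar_prod_def intro!: sum.cong)
    also have "\<dots> = (\<Sum>l\<in>{i,j}. E $$ (k,l) * (if l = i \<or> l = j then 1 else 0))"
      by (rule sum.mono_neutral_right) (use that in auto)
    finally show ?thesis by auto
  qed
  have "\<exists>i<n. \<exists>j<n. \<forall>x. E * v i j \<noteq> x \<cdot>\<^sub>m v i j"
  proof (rule ccontr)
    assume "\<not> ?thesis"
    then have eig: "\<exists>x. E * v i j = x \<cdot>\<^sub>m v i j" if "i < n" "j < n" for i j using that by auto
    have off: "E $$ (k,i) = 0" if "i < n" "k < n" "k \<noteq> i" for i k
    proof -
      from eig[OF that(1,1)] obtain x where x: "E * v i i = x \<cdot>\<^sub>m v i i" by blast
      have "E $$ (k,i) = (E * v i i) $$ (k,0)" using Ev[OF that(1,1,2)] by simp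
      then show ?thesis unfolding x using that by (simp add: v_def)
    qed
    have diag: "E $$ (i,i) = E $$ (j,j)" if "i < n" "j < n" for i j
    proof (cases "i = j")
      case False
      from eig[OF that] obtain x where x: "E * v i j = x \<cdot>\<^sub>m v i j" by blast
      have "E $$ (i,i) = (E * v i j) $$ (i,0)" "E $$ (j,j) = (E * v i j) $$ (j,0)"
        using Ev[OF that that(1)] Ev[OF that that(2)] off that False by auto
      then show ?thesis unfolding x using that by (simp add: v_def)
    qed simp
    have "E = E $$ (0,0) \<cdot>\<^sub>m 1\<^sub>m n"
    proof (intro eq_matI)
      fix i j assume "i < dim_row (E $$ (0,0) \<cdot>\<^sub>m 1\<^sub>m n)" "j < dim_col (E $$ (0,0) \<cdot>\<^sub>m 1\<^sub>m n)"
      then have "i < n" "j < n" by auto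
      then show "E $$ (i,j) = (E $$ (0,0) \<cdot>\<^sub>m 1\<^sub>m n) $$ (i,j)"
        using off[of j i] diag[of i 0] by auto
    qed (use E in auto)
    then show False using ns by blast
  qed
  then show thesis using that v by blast
qed

text \<open>In a basis starting with a vector that is not an eigenvector, the first column is
  nonzero below the corner, which allows the corner to be made 1.\<close>

lemma nonscalar_similar_block:
  fixes E :: "'a::field mat"
  assumes E: "E \<in> carrier_mat (1 + m) (1 + m)" and ns: "\<And>c. E \<noteq> c \<cdot>\<^sub>m 1\<^sub>m (1 + m)"
  obtains g g' r s S where "inverse_pair (1 + m) g g'" "r \<in> carrier_mat 1 m" "s \<in> carrier_mat m 1" "S \<in> carrier_mat m m"
    "s \<noteq> 0\<^sub>m m 1" "g * E * g' = four_block_mat (1\<^sub>m 1) r s S"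
proof -
  obtain v where v: "v \<in> carrier_mat (1 + m) 1" and ev: "\<And>x. E * v \<noteq> x \<cdot>\<^sub>m v"
    by (rule nonscalar_non_eigenvector[OF E ns]) auto
  have "v \<noteq> 0\<^sub>m (1 + m) 1" using ev[of 0] E by (auto intro!: eq_matI)
  then obtain g g' where g: "inverse_pair (1 + m) g g'" and gv: "g * v = unit_col (1 + m)"
    by (rule col_to_unit_col[OF v])
  have gc: "g \<in> carrier_mat (1 + m) (1 + m)" "g' \<in> carrier_mat (1 + m) (1 + m)"
    and inv: "g * g' = 1\<^sub>m (1 + m)" "g' * g = 1\<^sub>m (1 + m)" using g by (auto simp: inverse_pair_def)
  note d = carrier_matD[OF gc(1)] carrier_matD[OF gc(2)] carrier_matD[OF E] carrier_matD[OF v]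
  obtain \<alpha> r t D where c: "\<alpha> \<in> carrier_mat 1 1" "r \<in> carrier_mat 1 m" "t \<in> carrier_mat m 1" "D \<in> carrier_mat m m"
    and b: "g * E * g' = four_block_mat \<alpha> r t D"
    by (rule four_block_cases[of "g * E * g'" 1 m 1 m]) (use gc E in auto)
  have "t \<noteq> 0\<^sub>m m 1"
  proof
    assume t: "t = 0\<^sub>m m 1"
    have "g * (E * v) = g * E * g' * unit_col (1 + m)"
      unfolding gv[symmetric] by (simp add: d mat_mult_assoc mat_inverse_left[OF inv(2)])
    also have "\<dots> = four_block_mat \<alpha> (0\<^sub>m 1 0) (0\<^sub>m m 1) (0\<^sub>m m 0)"
      unfolding b unit_col_block t using c
      by (subst mult_four_block_mat[of _ 1 1 _ m _ m _ _ 1 _ 0]) (auto simp: mat_units intro!: cong_four_block_mat)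
    also have "\<dots> = \<alpha> $$ (0,0) \<cdot>\<^sub>m unit_col (1 + m)"
      using c by (intro eq_matI) (auto simp: unit_col_def)
    finally have "g' * (g * (E * v)) = g' * (\<alpha> $$ (0,0) \<cdot>\<^sub>m (g * v))" by (simp add: gv)
    also have "\<dots> = \<alpha> $$ (0,0) \<cdot>\<^sub>m (g' * (g * v))"
      using gc v by (intro mult_smult_distrib[of _ "1 + m" "1 + m" _ 1]) auto
    finally have "E * v = \<alpha> $$ (0,0) \<cdot>\<^sub>m v"
      by (simp add: d mat_inverse_left[OF inv(2)])
    then show False using ev by blast
  qed
  then obtain h r' D' where h: "h \<in> carrier_mat 1 m" "r' \<in> carrier_mat 1 m" "D' \<in> carrier_mat m m"
    and e: "four_block_mat (1\<^sub>m 1) h (0\<^sub>m m 1) (1\<^sub>m m) * four_block_mat \<alpha> r t D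
      * four_block_mat (1\<^sub>m 1) (- h) (0\<^sub>m m 1) (1\<^sub>m m) = four_block_mat (1\<^sub>m 1) r' t D'"
    by (rule conjugate_corner[OF c])
  let ?h = "four_block_mat (1\<^sub>m 1) h (0\<^sub>m m 1) (1\<^sub>m m)" and ?h' = "four_block_mat (1\<^sub>m 1) (- h) (0\<^sub>m m 1) (1\<^sub>m m)"
  have "?h * g * E * (g' * ?h') = four_block_mat (1\<^sub>m 1) r' t D'"
    unfolding e[symmetric] b[symmetric] using h by (simp add: d mat_mult_assoc)
  then show thesis
    by (rule that[OF inverse_pair_mult[OF g inverse_pair_upper[OF h(1)]] h(2) c(3) h(3) \<open>t \<noteq> 0\<^sub>m m 1\<close>])
qed

text \<open>Without row exchanges the pivots must be nonzero, and a basis starting with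
  \<open>s\<close> can be chosen to provide this: if \<open>t\<close> is nonzero, the corner is
  conjugated to 1, and otherwise invertibility makes it nonzero. \<open>U\<close> is the inverse of
  the usual upper factor. The clause \<open>m = 0\<close> serves the induction base, where every
  column is zero.\<close>

lemma LU_similar:
  fixes A :: "'a::field mat"
  assumes "A \<in> carrier_mat m m" "det A \<noteq> 0" "s \<in> carrier_mat m 1" "m = 0 \<or> s \<noteq> 0\<^sub>m m 1"
  shows "\<exists>g g' L U. inverse_pair m g g' \<and> L \<in> carrier_mat m m \<and> U \<in> carrier_mat m m \<and> g * s = unit_col m
    \<and> g * A * g' * U = L \<and> (\<forall>i<m. L $$ (i,i) = 1) \<and> (\<forall>i j. i < j \<longrightarrow> j < m \<longrightarrow> L $$ (i,j) = 0)
    \<and> (\<forall>i j. j < i \<longrightarrow> i < m \<longrightarrow> U $$ (i,j) = 0)"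
  using assms
proof (induction m arbitrary: A s)
  case 0
  then show ?case
    by (intro exI[of _ "1\<^sub>m 0"] exI[of _ A]) (auto simp: inverse_pair_def unit_col_def intro!: eq_matI)
next
  case (Suc m)
  have S: "Suc m = 1 + m" by simp
  note A = Suc.prems(1)[unfolded S] and s = Suc.prems(3)[unfolded S]
  obtain g g' where g: "inverse_pair (1 + m) g g'" and gs: "g * s = unit_col (1 + m)"
    by (rule col_to_unit_col[OF s]) (use Suc.prems(4) in auto)
  have gc: "g \<in> carrier_mat (1 + m) (1 + m)" "g' \<in> carrier_mat (1 + m) (1 + m)"
    and inv: "g * g' = 1\<^sub>m (1 + m)" "g' * g = 1\<^sub>m (1 + m)" using g by (auto simp: inverse_pair_def)
  obtain \<alpha> r t D where c: "\<alpha> \<in> carrier_mat 1 1" "r \<in> carrier_mat 1 m" "t \<in> carrier_mat m 1" "D \<in> carrier_mat m m"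
    and b: "g * A * g' = four_block_mat \<alpha> r t D"
    by (rule four_block_cases[of "g * A * g'" 1 m 1 m]) (use gc A in auto)
  have detb: "det (g * A * g') \<noteq> 0"
    using Suc.prems(2) inverse_det_nonzero[OF gc inv(1)] det_mult[OF gc(1) A]
      det_mult[of "g * A" "1 + m" g'] gc A by auto
  have "\<exists>h x r1 D1. h \<in> carrier_mat 1 m \<and> x \<noteq> 0 \<and> r1 \<in> carrier_mat 1 m \<and> D1 \<in> carrier_mat m m
    \<and> four_block_mat (1\<^sub>m 1) h (0\<^sub>m m 1) (1\<^sub>m m) * four_block_mat \<alpha> r t D
      * four_block_mat (1\<^sub>m 1) (- h) (0\<^sub>m m 1) (1\<^sub>m m) = four_block_mat (mat 1 1 (\<lambda>_. x)) r1 t D1"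
  proof (cases "t = 0\<^sub>m m 1")
    case True
    have "det (four_block_mat \<alpha> r t D) = det \<alpha> * det D"
      unfolding True by (rule det_four_block_mat_lower_left_zero[of _ 1 _ m]) (use c in auto)
    then have "\<alpha> $$ (0,0) \<noteq> 0" using detb det_single[OF c(1)] unfolding b by auto
    then show ?thesis using c single_cases[OF c(1)]
      by (intro exI[of _ "0\<^sub>m 1 m"] exI[of _ "\<alpha> $$ (0,0)"] exI[of _ r] exI[of _ D]) (auto simp: mat_cancel)
  next
    case False
    obtain h r' D' where "h \<in> carrier_mat 1 m" "r' \<in> carrier_mat 1 m" "D' \<in> carrier_mat m m"
      "four_block_mat (1\<^sub>m 1) h (0\<^sub>m m 1) (1\<^sub>m m) * four_block_mat \<alpha> r t D
      * four_block_mat (1\<^sub>m 1) (- h) (0\<^sub>m m 1) (1\<^sub>m m) = four_block_mat (1\<^sub>m 1) r' t D'"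
      by (rule conjugate_corner[OF c False])
    then show ?thesis unfolding single_mult(2)
      by (intro exI[of _ h] exI[of _ 1] exI[of _ r'] exI[of _ D']) auto
  qed
  then obtain h x r1 D1 where h: "h \<in> carrier_mat 1 m" and x: "x \<noteq> 0" and c1: "r1 \<in> carrier_mat 1 m" "D1 \<in> carrier_mat m m"
    and e: "four_block_mat (1\<^sub>m 1) h (0\<^sub>m m 1) (1\<^sub>m m) * four_block_mat \<alpha> r t D
      * four_block_mat (1\<^sub>m 1) (- h) (0\<^sub>m m 1) (1\<^sub>m m) = four_block_mat (mat 1 1 (\<lambda>_. x)) r1 t D1" by blast
  let ?u = "four_block_mat (1\<^sub>m 1) h (0\<^sub>m m 1) (1\<^sub>m m)" and ?u' = "four_block_mat (1\<^sub>m 1) (- h) (0\<^sub>m m 1) (1\<^sub>m m)"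
  let ?x = "mat 1 1 (\<lambda>_. x)"
  define y where "y = mat 1 1 (\<lambda>_. 1 / x)"
  have yc: "y \<in> carrier_mat 1 1" by (simp add: y_def)
  have xy: "?x * y = 1\<^sub>m 1" "y * ?x = 1\<^sub>m 1" using x unfolding y_def single_mult by simp_all
  note upair = inverse_pair_upper[OF h]
  have uc: "?u \<in> carrier_mat (1 + m) (1 + m)" "?u' \<in> carrier_mat (1 + m) (1 + m)"
    and uinv: "?u * ?u' = 1\<^sub>m (1 + m)" using upair by (auto simp: inverse_pair_def)
  \<comment> \<open>Schur complement of the corner, to which the induction hypothesis is
    applied.\<close>
  define A1 where "A1 = D1 - t * y * r1"
  have A1: "A1 \<in> carrier_mat m m" using c c1 yc unfolding A1_def by auto
  have bc: "four_block_mat \<alpha> r t D \<in> carrier_mat (1 + m) (1 + m)" using c by auto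
  have "det (?u * four_block_mat \<alpha> r t D * ?u') \<noteq> 0"
    using detb[unfolded b] inverse_det_nonzero[OF uc uinv] det_mult[OF uc(1) bc]
      det_mult[of "?u * four_block_mat \<alpha> r t D" "1 + m" ?u'] uc bc by auto
  moreover have "four_block_mat ?x r1 t D1
    = four_block_mat (1\<^sub>m 1) (0\<^sub>m 1 m) (t * y) (1\<^sub>m m) * four_block_mat ?x r1 (0\<^sub>m m 1) A1"
    using c c1 yc A1 xy
    by (subst lower_mult[of _ m 1 _ 1 _ m]) (auto simp: A1_def mat_ring intro!: cong_four_block_mat)
  moreover have "det (four_block_mat (1\<^sub>m 1) (0\<^sub>m 1 m) (t * y) (1\<^sub>m m) * four_block_mat ?x r1 (0\<^sub>m m 1) A1)
    = det ?x * det A1"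
    using c c1 yc A1
    by (subst det_lower_mult) (auto intro!: det_four_block_mat_lower_left_zero[of _ 1 _ m])
  ultimately have detA1: "det A1 \<noteq> 0" unfolding e by auto
  \<comment> \<open>The induction hypothesis wants some nonzero column; whatever \<open>k\<close> it
    returns, \<open>?k\<close> fixes \<open>unit_col (1 + m)\<close>.\<close>
  have "m = 0 \<or> unit_col m \<noteq> (0\<^sub>m m 1 :: 'a mat)" using unit_col_nonzero[of m] by auto
  from Suc.IH[OF A1 detA1 unit_col_carrier this]
  obtain k k' L U where k: "inverse_pair m k k'" and LU: "L \<in> carrier_mat m m" "U \<in> carrier_mat m m"
    and kA: "k * A1 * k' * U = L" and L1: "\<forall>i<m. L $$ (i,i) = 1" and L0: "\<forall>i j. i < j \<longrightarrow> j < m \<longrightarrow> L $$ (i,j) = 0"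
    and U0: "\<forall>i j. j < i \<longrightarrow> i < m \<longrightarrow> U $$ (i,j) = 0"
    by (elim exE conjE) (rule that)
  have kc: "k \<in> carrier_mat m m" "k' \<in> carrier_mat m m" using k by (auto simp: inverse_pair_def)
  let ?k = "four_block_mat (1\<^sub>m 1) (0\<^sub>m 1 m) (0\<^sub>m m 1) k" and ?k' = "four_block_mat (1\<^sub>m 1) (0\<^sub>m 1 m) (0\<^sub>m m 1) k'"
  have kpair: "inverse_pair (1 + m) ?k ?k'" by (rule inverse_pair_diag[OF inverse_pair_one k])
  have kkc: "?k \<in> carrier_mat (1 + m) (1 + m)" "?k' \<in> carrier_mat (1 + m) (1 + m)"
    using kpair by (auto simp: inverse_pair_def)
  let ?L = "four_block_mat (1\<^sub>m 1) (0\<^sub>m 1 m) (k * t * y) L"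
  \<comment> \<open>As \<open>?x * y = 1\<close>, the upper right block cancels
    \<open>r1 * k' * U\<close> in the product.\<close>
  let ?U = "four_block_mat y (- (y * r1 * k' * U)) (0\<^sub>m m 1) U"
  note cs = c c1 yc A1 kc LU gc uc kkc A s
  note d = cs[THEN carrier_matD(1)] cs[THEN carrier_matD(2)]
  have 1: "inverse_pair (1 + m) (?k * (?u * g)) (g' * ?u' * ?k')"
    by (rule inverse_pair_mult[OF inverse_pair_mult[OF g upair] kpair])
  have us: "?u * unit_col (1 + m) = unit_col (1 + m)"
    unfolding unit_col_block using h
    by (subst upper_mult[of _ 1 m _ 1 _ 0]) (auto simp: mat_units intro!: cong_four_block_mat)
  have ks: "?k * unit_col (1 + m) = unit_col (1 + m)"
    unfolding unit_col_block using kc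
    by (subst mult_four_block_mat[of _ 1 1 _ m _ m _ _ 1 _ 0]) (auto simp: mat_units intro!: cong_four_block_mat)
  have "?k * (?u * g) * s = ?k * (?u * (g * s))" by (simp add: d mat_mult_assoc)
  then have 2: "?k * (?u * g) * s = unit_col (1 + m)" unfolding gs us ks .
  have "?k * (?u * g) * A * (g' * ?u' * ?k') * ?U = ?k * (?u * (g * A * g') * ?u') * ?k' * ?U"
    by (simp add: d mat_mult_assoc)
  also have "\<dots> = ?k * four_block_mat ?x r1 t D1 * ?k' * ?U" unfolding b e ..
  also have "?k * four_block_mat ?x r1 t D1 = four_block_mat ?x r1 (k * t) (k * D1)"
    using cs by (subst mult_four_block_mat[of _ 1 1 _ m _ m _ _ 1 _ m]) (auto simp: mat_units intro!: cong_four_block_mat)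
  also have "\<dots> * ?k' = four_block_mat ?x (r1 * k') (k * t) (k * D1 * k')"
    using cs by (subst mult_four_block_mat[of _ 1 1 _ m _ m _ _ 1 _ m]) (auto simp: mat_units intro!: cong_four_block_mat)
  also have "\<dots> * ?U = ?L"
  proof -
    have 1: "?x * (- (y * r1 * k' * U)) + r1 * k' * U = 0\<^sub>m 1 m"
    proof -
      have "?x * (- (y * r1 * k' * U)) + r1 * k' * U = - (?x * y * (r1 * k' * U)) + r1 * k' * U"
        by (simp add: d mat_ring)
      also have "\<dots> = 0\<^sub>m 1 m" unfolding xy by (simp add: d mat_ring)
      finally show ?thesis .
    qed
    have 2: "k * t * (- (y * r1 * k' * U)) + k * D1 * k' * U = L"
      unfolding kA[symmetric] A1_def by (simp add: d mat_ring)
    have "four_block_mat ?x (r1 * k') (k * t) (k * D1 * k') * ?U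
      = four_block_mat (?x * y + r1 * k' * 0\<^sub>m m 1) (?x * (- (y * r1 * k' * U)) + r1 * k' * U)
        (k * t * y + k * D1 * k' * 0\<^sub>m m 1) (k * t * (- (y * r1 * k' * U)) + k * D1 * k' * U)"
      by (rule mult_four_block_mat[of _ 1 1 _ m _ m _ _ 1 _ m]; rule carrier_matI; simp add: d)
    also have "\<dots> = ?L"
      unfolding 1 2 xy by (simp add: d mat_units)
    finally show ?thesis .
  qed
  finally have 3: "?k * (?u * g) * A * (g' * ?u' * ?k') * ?U = ?L" .
  have 4: "\<forall>i<1 + m. ?L $$ (i,i) = 1" "\<forall>i j. i < j \<longrightarrow> j < 1 + m \<longrightarrow> ?L $$ (i,j) = 0"
    "\<forall>i j. j < i \<longrightarrow> i < 1 + m \<longrightarrow> ?U $$ (i,j) = 0"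
    using L1 L0 U0 LU yc by (auto simp: d)
  have 5: "?L \<in> carrier_mat (1 + m) (1 + m)" "?U \<in> carrier_mat (1 + m) (1 + m)"
    by (rule carrier_matI; simp add: d)+
  show ?case unfolding S
    by (intro exI conjI) (fact 1 2 3 4 5)+
qed

section \<open>Krylov matrices and powers of Hessenberg matrices\<close>

definition shift_mat :: "nat \<Rightarrow> 'a::field mat" where
  "shift_mat m = mat m m (\<lambda>(i,j). if i = Suc j then 1 else 0)"

text \<open>The rows are the Krylov sequence of the last unit row, by descending powers of
  \<open>Y\<close>. In this order the matrix is lower triangular for a strictly lower
  \<open>Y\<close> and upper triangular for a Hessenberg \<open>Y\<close>.\<close>

definition krylov_mat :: "nat \<Rightarrow> 'a::field mat \<Rightarrow> 'a mat" where
  "krylov_mat m Y = mat m m (\<lambda>(i,j). (Y ^\<^sub>m (m - 1 - i)) $$ (m - 1, j))"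

lemma pow_mat_index_Suc:
  fixes Y :: "'a::field mat"
  assumes "Y \<in> carrier_mat m m" "i < m" "j < m"
  shows "(Y ^\<^sub>m Suc k) $$ (i,j) = (\<Sum>l\<in>{0..<m}. (Y ^\<^sub>m k) $$ (i,l) * Y $$ (l,j))"
  using assms pow_carrier_mat[OF assms(1), of k] by (auto simp: scalar_prod_def)

text \<open>Multiplication by \<open>Y\<close> turns row \<open>i\<close> into row
  \<open>i - 1\<close>, as the cyclic matrix does from the left. Only row 0 differs: it is the last
  row of the \<open>m\<close>-th power of \<open>Y\<close> on one side and the last unit row on the
  other. For an invertible Krylov matrix this is the companion form.\<close>

lemma krylov_mat_mult:
  fixes Y :: "'a::field mat"
  assumes Y: "Y \<in> carrier_mat m m" and m: "m > 0"
  shows "krylov_mat m Y * Y = cyclic_mat m * krylov_mat m Y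
    + unit_col m * mat 1 m (\<lambda>(_,j). (Y ^\<^sub>m m) $$ (m - 1, j) - (if j = m - 1 then 1 else 0))"
proof (intro eq_matI)
  let ?K = "krylov_mat m Y"
  let ?r = "mat 1 m (\<lambda>(_,j). (Y ^\<^sub>m m) $$ (m - 1, j) - (if j = m - 1 then 1 else 0))"
  fix i j assume "i < dim_row (cyclic_mat m * ?K + unit_col m * ?r)" "j < dim_col (cyclic_mat m * ?K + unit_col m * ?r)"
  then have ij: "i < m" "j < m" by (auto simp: cyclic_mat_def unit_col_def)
  define p where "p = (if i = 0 then m - 1 else i - 1)"
  have p: "p < m" "Suc p mod m = i" using ij by (auto simp: p_def)
  have "(?K * Y) $$ (i,j) = (\<Sum>l\<in>{0..<m}. (Y ^\<^sub>m (m - 1 - i)) $$ (m - 1, l) * Y $$ (l,j))"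
    using ij Y by (auto simp: krylov_mat_def scalar_prod_def)
  also have "\<dots> = (Y ^\<^sub>m (Suc (m - 1 - i))) $$ (m - 1, j)"
    using ij m by (intro pow_mat_index_Suc[OF Y, symmetric]) auto
  also have "Suc (m - 1 - i) = m - i" using ij by simp
  finally have 1: "(?K * Y) $$ (i,j) = (Y ^\<^sub>m (m - i)) $$ (m - 1, j)" .
  have "(cyclic_mat m * ?K) $$ (i,j) = (\<Sum>l\<in>{0..<m}. (if i = Suc l mod m then 1 else 0) * ?K $$ (l,j))"
    using ij by (auto simp: krylov_mat_def cyclic_mat_def scalar_prod_def intro!: sum.cong)
  also have "\<dots> = (\<Sum>l\<in>{0..<m}. if l = p then ?K $$ (l,j) else 0)"
  proof (rule sum.cong[OF refl])
    fix l assume "l \<in> {0..<m}"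
    then have "i = Suc l mod m \<longleftrightarrow> l = p" using Suc_mod_inj p by (metis atLeastLessThan_iff)
    then show "(if i = Suc l mod m then 1 else 0) * ?K $$ (l,j) = (if l = p then ?K $$ (l,j) else 0)" by simp
  qed
  also have "\<dots> = ?K $$ (p, j)" using p(1) by simp
  finally have 2: "(cyclic_mat m * ?K) $$ (i,j) = ?K $$ (p, j)" .
  have 3: "(unit_col m * ?r) $$ (i,j) = (if i = 0 then ?r $$ (0,j) else 0)"
    using ij by (auto simp: unit_col_def scalar_prod_def)
  have "?K $$ (p, j) = (if i = 0 then (if j = m - 1 then 1 else 0) else (Y ^\<^sub>m (m - i)) $$ (m - 1, j))"
    using ij Y by (auto simp: krylov_mat_def p_def)
  then show "(?K * Y) $$ (i,j) = (cyclic_mat m * ?K + unit_col m * ?r) $$ (i,j)"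
    using 1 2 3 ij by (simp add: krylov_mat_def cyclic_mat_def unit_col_def)
qed (use Y in \<open>auto simp: krylov_mat_def cyclic_mat_def unit_col_def\<close>)

text \<open>The entry sums over paths of \<open>k\<close> steps from \<open>m - 1\<close> to
  \<open>j\<close>. Each step lowers the index by at least one, with weight 1 if by exactly one, so
  for \<open>m - 1 \<le> j + k\<close> only a path of unit steps can contribute.\<close>

lemma lower_pow_last_row:
  fixes Y :: "'a::field mat"
  assumes Y: "Y \<in> carrier_mat m m" and m: "m > 0"
    and low: "\<And>l j. l < m \<Longrightarrow> j < m \<Longrightarrow> l \<le> j \<Longrightarrow> Y $$ (l,j) = 0"
    and sub: "\<And>l j. l < m \<Longrightarrow> j < m \<Longrightarrow> l = Suc j \<Longrightarrow> Y $$ (l,j) = 1"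
    and j: "j < m" "m - 1 \<le> j + k"
  shows "(Y ^\<^sub>m k) $$ (m - 1, j) = (if j + k = m - 1 then 1 else 0)"
  using j
proof (induction k arbitrary: j)
  case 0
  then show ?case using Y by auto
next
  case (Suc k)
  have "(Y ^\<^sub>m Suc k) $$ (m - 1, j) = (\<Sum>l\<in>{0..<m}. (Y ^\<^sub>m k) $$ (m - 1, l) * Y $$ (l,j))"
    using Suc.prems m by (intro pow_mat_index_Suc[OF Y]) auto
  also have "\<dots> = (\<Sum>l\<in>{0..<m}. if l = Suc j \<and> j + Suc k = m - 1 then 1 else 0)"
  proof (rule sum.cong[OF refl])
    fix l assume "l \<in> {0..<m}"
    then have l: "l < m" by simp
    consider "l \<le> j" | "l = Suc j" | "l > Suc j" by linarith
    then show "(Y ^\<^sub>m k) $$ (m - 1, l) * Y $$ (l,j) = (if l = Suc j \<and> j + Suc k = m - 1 then 1 else 0)"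
      using Suc.IH[OF l] low[OF l Suc.prems(1)] sub[OF l Suc.prems(1)] Suc.prems by cases auto
  qed
  also have "\<dots> = (if j + Suc k = m - 1 then 1 else 0)"
    by (cases "j + Suc k = m - 1") auto
  finally show ?case .
qed

text \<open>Here each step lowers the index by at most one: \<open>j\<close> is out of reach if
  \<open>j + k < m - 1\<close>, and at equality there is one path, whose weight is a product of
  subdiagonal entries.\<close>

lemma hessenberg_pow_last_row:
  fixes Y :: "'a::field mat"
  assumes Y: "Y \<in> carrier_mat m m" and m: "m > 0"
    and up: "\<And>l j. l < m \<Longrightarrow> j < m \<Longrightarrow> Suc j < l \<Longrightarrow> Y $$ (l,j) = 0"
    and sub: "\<And>l j. l < m \<Longrightarrow> j < m \<Longrightarrow> l = Suc j \<Longrightarrow> Y $$ (l,j) \<noteq> 0"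
    and j: "j < m" "j + k \<le> m - 1"
  shows "(Y ^\<^sub>m k) $$ (m - 1, j) = 0 \<longleftrightarrow> j + k < m - 1"
  using j
proof (induction k arbitrary: j)
  case 0
  then show ?case using Y by auto
next
  case (Suc k)
  have *: "Suc j < m" using Suc.prems by auto
  have "(Y ^\<^sub>m Suc k) $$ (m - 1, j) = (\<Sum>l\<in>{0..<m}. (Y ^\<^sub>m k) $$ (m - 1, l) * Y $$ (l,j))"
    using Suc.prems m by (intro pow_mat_index_Suc[OF Y]) auto
  also have "\<dots> = (\<Sum>l\<in>{Suc j}. (Y ^\<^sub>m k) $$ (m - 1, l) * Y $$ (l,j))"
  proof (rule sum.mono_neutral_right)
    show "\<forall>l\<in>{0..<m} - {Suc j}. (Y ^\<^sub>m k) $$ (m - 1, l) * Y $$ (l,j) = 0"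
    proof
      fix l assume l: "l \<in> {0..<m} - {Suc j}"
      show "(Y ^\<^sub>m k) $$ (m - 1, l) * Y $$ (l,j) = 0"
        using Suc.IH[of l] up[of l j] Suc.prems l by (cases "l < Suc j") auto
    qed
  qed (use * in auto)
  finally show ?case using Suc.IH[OF *] sub[OF * Suc.prems(1)] Suc.prems by auto
qed

section \<open>Commutators up to a transvection\<close>

lemma mult_if_one_zero: "x * (if b then 1 else 0) = (if b then x else (0 :: 'a::field))"
  by simp

lemma unit_lower_det:
  fixes L :: "'a::field mat"
  assumes "L \<in> carrier_mat m m" "\<forall>i<m. L $$ (i,i) = 1" "\<forall>i j. i < j \<longrightarrow> j < m \<longrightarrow> L $$ (i,j) = 0"
  shows "det L = 1"
proof -
  have "det L = (\<Prod>i\<in>{0..<m}. L $$ (i,i))"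
    using det_lower_triangular[of m L] assms by (simp add: prod_list_diag_prod)
  then show ?thesis using assms by simp
qed

lemma upper_det:
  fixes U :: "'a::field mat"
  assumes "U \<in> carrier_mat m m" "\<forall>i j. j < i \<longrightarrow> i < m \<longrightarrow> U $$ (i,j) = 0"
  shows "det U = (\<Prod>i\<in>{0..<m}. U $$ (i,i))"
  using det_upper_triangular[of U m] assms by (auto simp: prod_list_diag_prod)

lemma mult_unit_col:
  fixes K :: "'a::field mat"
  assumes "K \<in> carrier_mat m m" "\<forall>i j. j < i \<longrightarrow> i < m \<longrightarrow> K $$ (i,j) = 0" "m > 0"
  shows "K * unit_col m = K $$ (0,0) \<cdot>\<^sub>m unit_col m"
proof (intro eq_matI)
  fix i j assume "i < dim_row (K $$ (0,0) \<cdot>\<^sub>m unit_col m)" "j < dim_col (K $$ (0,0) \<cdot>\<^sub>m unit_col m)"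
  then have ij: "i < m" "j = 0" by (auto simp: unit_col_def)
  have "(K * unit_col m) $$ (i,0) = (\<Sum>l\<in>{0..<m}. if l = 0 then K $$ (i,l) else 0)"
    using ij assms by (auto simp: unit_col_def scalar_prod_def mult_if_one_zero)
  also have "\<dots> = K $$ (i,0)" using assms(3) by simp
  finally show "(K * unit_col m) $$ (i,j) = (K $$ (0,0) \<cdot>\<^sub>m unit_col m) $$ (i,j)"
    using ij assms by (auto simp: unit_col_def)
qed (use assms in \<open>auto simp: unit_col_def\<close>)

text \<open>The last column of \<open>C\<close> is whatever makes \<open>L C\<close> conjugate to the cyclic matrix.\<close>

lemma lower_times_hessenberg_cyclic:
  fixes L :: "'a::field mat"
  assumes L: "L \<in> carrier_mat m m" "\<forall>i<m. L $$ (i,i) = 1" "\<forall>i j. i < j \<longrightarrow> j < m \<longrightarrow> L $$ (i,j) = 0"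
    and m: "m > 0"
  obtains C K K' where "C \<in> carrier_mat m m" "inverse_pair m K K'" "L * C = K' * cyclic_mat m * K"
    "\<And>i j. i < m \<Longrightarrow> Suc j < m \<Longrightarrow> C $$ (i,j) = (if i = Suc j then 1 else 0)"
proof -
  \<comment> \<open>The columns of \<open>L\<close> moved one place to the left: strictly lower
    triangular with ones on the subdiagonal.\<close>
  define Y where "Y = L * shift_mat m"
  have N: "shift_mat m \<in> carrier_mat m m" by (simp add: shift_mat_def)
  have Y: "Y \<in> carrier_mat m m" unfolding Y_def by (rule mult_carrier_mat[OF L(1) N])
  have Yi: "Y $$ (i,j) = (if Suc j < m then L $$ (i, Suc j) else 0)" if "i < m" "j < m" for i j
  proof -
    have "Y $$ (i,j) = (\<Sum>l\<in>{0..<m}. if l = Suc j then L $$ (i,l) else 0)"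
      using that L by (auto simp: Y_def shift_mat_def scalar_prod_def mult_if_one_zero)
    then show ?thesis by simp
  qed
  have pow: "(Y ^\<^sub>m k) $$ (m - 1, j) = (if j + k = m - 1 then 1 else 0)" if "j < m" "m - 1 \<le> j + k" for j k
    by (rule lower_pow_last_row[OF Y m _ _ that]) (use Yi L in auto)
  define K where "K = krylov_mat m Y"
  have K: "K \<in> carrier_mat m m" by (simp add: K_def krylov_mat_def)
  have Ki: "K $$ (i,j) = (if i = j then 1 else 0)" if "i < m" "j < m" "i \<le> j" for i j
    using pow[of j "m - 1 - i"] that by (auto simp: K_def krylov_mat_def)
  have "det K = 1" by (rule unit_lower_det[OF K]) (use Ki in auto)
  then obtain K' where K': "K' \<in> carrier_mat m m" "K * K' = 1\<^sub>m m" "K' * K = 1\<^sub>m m"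
    using det_nonzero_inverse[OF K] by auto
  have "det L = 1" by (rule unit_lower_det[OF L])
  then obtain L' where L': "L' \<in> carrier_mat m m" "L * L' = 1\<^sub>m m" "L' * L = 1\<^sub>m m"
    using det_nonzero_inverse[OF L(1)] by auto
  let ?c = "cyclic_mat m :: 'a mat" and ?u = "unit_col m :: 'a mat"
  let ?r = "mat 1 m (\<lambda>(_,j). (Y ^\<^sub>m m) $$ (m - 1, j) - (if j = m - 1 then 1 else 0)) :: 'a mat"
  \<comment> \<open>The last row of the \<open>m\<close>-th power of \<open>Y\<close> is zero, so
    the deviation \<open>?r\<close> is supported on the last column. Hence \<open>C\<close> differs
    from \<open>shift_mat m\<close> only there.\<close>
  have r: "?r = mat 1 m (\<lambda>(_,j). if j = m - 1 then - 1 else 0)"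
    using pow[of _ m] m by (intro eq_matI) auto
  define \<omega> where "\<omega> = L' * (K' * ?u)"
  define e where "e = mat 1 m (\<lambda>(_,j). if j = m - 1 then - 1 else (0::'a))"
  define C where "C = L' * (K' * (?c * K))"
  note cs = L(1) L'(1) N Y K K'(1) cyclic_mat_carrier[of m, where 'a = 'a] unit_col_carrier[of m, where 'a = 'a]
  have ec: "e \<in> carrier_mat 1 m" by (simp add: e_def)
  note d = cs[THEN carrier_matD(1)] cs[THEN carrier_matD(2)] carrier_matD[OF ec]
  have kr: "K * Y = ?c * K + ?u * e"
    using krylov_mat_mult[OF Y m] unfolding r K_def[symmetric] e_def .
  have "shift_mat m = L' * (K' * (K * (L * shift_mat m)))"
    by (simp add: d mat_mult_assoc mat_inverse_left[OF K'(3)] mat_inverse_left[OF L'(3)])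
  also have "\<dots> = C + \<omega> * e"
    unfolding Y_def[symmetric] kr C_def \<omega>_def by (simp add: d mat_mult_assoc mat_mult_add)
  finally have NC: "shift_mat m = C + \<omega> * e" .
  have \<omega>: "\<omega> \<in> carrier_mat m 1" and C: "C \<in> carrier_mat m m"
    unfolding \<omega>_def C_def by (rule carrier_matI; simp add: d)+
  have Ci: "C $$ (i,j) = (if i = Suc j then 1 else 0)" if "i < m" "Suc j < m" for i j
  proof -
    have "shift_mat m $$ (i,j) = C $$ (i,j) + (\<omega> * e) $$ (i,j)"
      unfolding NC using that C \<omega> ec by (subst index_add_mat) auto
    moreover have "(\<omega> * e) $$ (i,j) = 0"
      using that \<omega> by (auto simp: e_def scalar_prod_def)
    moreover have "shift_mat m $$ (i,j) = (if i = Suc j then 1 else (0::'a))"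
      using that by (simp add: shift_mat_def)
    ultimately show ?thesis by simp
  qed
  have "L * C = K' * ?c * K"
    unfolding C_def by (simp add: d mat_mult_assoc mat_inverse_left[OF L'(2)])
  moreover have "inverse_pair m K K'" using K K' by (simp add: inverse_pair_def)
  ultimately show thesis using that C Ci by blast
qed

text \<open>In the Krylov basis \<open>K\<close> the deviation from the cyclic matrix sits in the
  first row. As \<open>K\<close> is upper triangular, its inverse sends \<open>unit_col m\<close> to
  a multiple of itself, so the deviation is still in the first row after changing back.\<close>

lemma hessenberg_first_row:
  fixes Z :: "'a::field mat"
  assumes Z: "Z \<in> carrier_mat m m" and m: "m > 0"
    and up: "\<And>l j. l < m \<Longrightarrow> j < m \<Longrightarrow> Suc j < l \<Longrightarrow> Z $$ (l,j) = 0"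
    and sub: "\<And>l j. l < m \<Longrightarrow> j < m \<Longrightarrow> l = Suc j \<Longrightarrow> Z $$ (l,j) \<noteq> 0"
  obtains K K' \<rho> where "inverse_pair m K K'" "\<rho> \<in> carrier_mat 1 m"
    "Z = K' * cyclic_mat m * K + unit_col m * \<rho>"
proof -
  define K where "K = krylov_mat m Z"
  have K: "K \<in> carrier_mat m m" by (simp add: K_def krylov_mat_def)
  have Ki: "K $$ (i,j) = 0 \<longleftrightarrow> j < i" if "i < m" "j < m" "j \<le> i" for i j
    using hessenberg_pow_last_row[OF Z m up sub, of j "m - 1 - i"] that
    by (auto simp: K_def krylov_mat_def)
  have Ku: "\<forall>i j. j < i \<longrightarrow> i < m \<longrightarrow> K $$ (i,j) = 0" using Ki by auto
  have "det K \<noteq> 0" unfolding upper_det[OF K Ku] using Ki by auto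
  then obtain K' where K': "K' \<in> carrier_mat m m" "K * K' = 1\<^sub>m m" "K' * K = 1\<^sub>m m"
    using det_nonzero_inverse[OF K] by auto
  let ?c = "cyclic_mat m :: 'a mat" and ?u = "unit_col m :: 'a mat"
  let ?r = "mat 1 m (\<lambda>(_,j). (Z ^\<^sub>m m) $$ (m - 1, j) - (if j = m - 1 then 1 else 0)) :: 'a mat"
  define r where "r = ?r"
  have rc: "r \<in> carrier_mat 1 m" by (simp add: r_def)
  note cs = Z K K'(1) cyclic_mat_carrier[of m, where 'a = 'a] unit_col_carrier[of m, where 'a = 'a] rc
  note d = cs[THEN carrier_matD(1)] cs[THEN carrier_matD(2)]
  have kr: "K * Z = ?c * K + ?u * r"
    using krylov_mat_mult[OF Z m] unfolding K_def[symmetric] r_def .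
  define x where "x = K $$ (0,0)"
  have x: "x \<noteq> 0" using Ki[of 0 0] m by (simp add: x_def)
  have "K' * (K * ?u) = x \<cdot>\<^sub>m (K' * ?u)"
    unfolding mult_unit_col[OF K Ku m] x_def using cs by (intro mult_smult_distrib[of _ m m _ 1]) auto
  then have "?u = x \<cdot>\<^sub>m (K' * ?u)" by (simp add: d mat_inverse_left[OF K'(3)])
  then have "(1 / x) \<cdot>\<^sub>m ?u = (1 / x) \<cdot>\<^sub>m (x \<cdot>\<^sub>m (K' * ?u))" by (rule arg_cong)
  also have "\<dots> = K' * ?u" using x by (intro eq_matI) auto
  finally have Ku': "K' * ?u = (1 / x) \<cdot>\<^sub>m ?u" by simp
  have "Z = K' * (K * Z)" by (simp add: d mat_inverse_left[OF K'(3)])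
  also have "\<dots> = K' * ?c * K + K' * ?u * r"
    unfolding kr by (simp add: d mat_mult_assoc mat_mult_add)
  also have "K' * ?u * r = ?u * ((1 / x) \<cdot>\<^sub>m r)"
    unfolding Ku' using cs by (simp add: mult_smult_distrib[of _ m 1 _ m] mult_smult_assoc_mat[of _ m 1 _ m])
  finally show thesis
    by (rule that[rotated 2]) (use K K' rc in \<open>auto simp: inverse_pair_def\<close>)
qed

lemma det_one_plus_unit_col:
  fixes \<sigma> :: "'a::field mat"
  assumes "\<sigma> \<in> carrier_mat 1 m" "m > 0"
  shows "det (1\<^sub>m m + unit_col m * \<sigma>) = 1 + \<sigma> $$ (0,0)" "\<sigma> * unit_col m = mat 1 1 (\<lambda>_. \<sigma> $$ (0,0))"
proof -
  let ?T = "1\<^sub>m m + unit_col m * \<sigma>"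
  have T: "?T \<in> carrier_mat m m" using assms by (auto simp: unit_col_def)
  have Ti: "?T $$ (i,j) = (if i = j then 1 else 0) + (if i = 0 then \<sigma> $$ (0,j) else 0)" if "i < m" "j < m" for i j
    using that assms by (auto simp: unit_col_def scalar_prod_def)
  have "det ?T = (\<Prod>i\<in>{0..<m}. ?T $$ (i,i))" by (rule upper_det[OF T]) (use Ti in auto)
  also have "\<dots> = (\<Prod>i\<in>{0..<m}. if i = 0 then 1 + \<sigma> $$ (0,0) else 1)"
    by (rule prod.cong) (use Ti in auto)
  also have "\<dots> = 1 + \<sigma> $$ (0,0)" using assms(2) by simp
  finally show "det ?T = 1 + \<sigma> $$ (0,0)" .
  have "(\<sigma> * unit_col m) $$ (0,0) = (\<Sum>l\<in>{0..<m}. if l = 0 then \<sigma> $$ (0,l) else 0)"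
    using assms by (auto simp: unit_col_def scalar_prod_def mult_if_one_zero)
  then show "\<sigma> * unit_col m = mat 1 1 (\<lambda>_. \<sigma> $$ (0,0))"
    using assms by (intro eq_matI) (auto simp: unit_col_def)
qed

lemma det_conjugate:
  fixes X :: "'a::field mat"
  assumes "inverse_pair m g g'" "X \<in> carrier_mat m m"
  shows "det (g * X * g') = det X"
proof -
  have c: "g \<in> carrier_mat m m" "g' \<in> carrier_mat m m" and inv: "g * g' = 1\<^sub>m m"
    using assms by (auto simp: inverse_pair_def)
  have "det g * det g' = 1" using det_mult[OF c] inv by simp
  moreover have "det (g * X * g') = det g * det X * det g'"
    using c assms(2) by (subst det_mult[of _ m], simp, simp, subst det_mult[of _ m]) auto
  ultimately show ?thesis by (metis mult.commute mult.left_commute mult_1)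
qed

lemma inverse_pair_swap: "inverse_pair m g g' \<Longrightarrow> inverse_pair m g' g"
  by (auto simp: inverse_pair_def)

text \<open>With \<open>C\<close> chosen so that \<open>X = L C\<close> is conjugate to the cyclic matrix, \<open>R X = U C\<close> is an
  unreduced Hessenberg matrix, and the change of its first row that makes it conjugate to the cyclic
  matrix as well is a transvection because the determinants agree.\<close>

lemma transvection_commutator_LU:
  fixes R :: "'a::field mat"
  assumes R: "R \<in> carrier_mat m m" "det R = 1" and m: "m > 0"
    and L: "L \<in> carrier_mat m m" "\<forall>i<m. L $$ (i,i) = 1" "\<forall>i j. i < j \<longrightarrow> j < m \<longrightarrow> L $$ (i,j) = 0"
    and U: "U \<in> carrier_mat m m" "\<forall>i j. j < i \<longrightarrow> i < m \<longrightarrow> U $$ (i,j) = 0"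
    and RL: "R * L = U"
  obtains w X W W' where "w \<in> carrier_mat 1 m" "X \<in> carrier_mat m m" "det X \<noteq> 0" "inverse_pair m W W'"
    "w * unit_col m = 0\<^sub>m 1 1" "(1\<^sub>m m + unit_col m * w) * R * X = W * X * W'"
proof -
  let ?c = "cyclic_mat m :: 'a mat" and ?u = "unit_col m :: 'a mat"
  obtain C K K' where C: "C \<in> carrier_mat m m" and K: "inverse_pair m K K'" and LC: "L * C = K' * ?c * K"
    and Ci: "\<And>i j. i < m \<Longrightarrow> Suc j < m \<Longrightarrow> C $$ (i,j) = (if i = Suc j then 1 else 0)"
    by (rule lower_times_hessenberg_cyclic[OF L m]) blast
  define X where "X = L * C"
  define Z where "Z = U * C"
  have X: "X \<in> carrier_mat m m" and Z: "Z \<in> carrier_mat m m" using L U C by (auto simp: X_def Z_def)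
  have RX: "R * X = Z" unfolding X_def Z_def RL[symmetric] using R L C by simp
  have "det U = det R * det L" unfolding RL[symmetric] using R L by (simp add: det_mult[of _ m])
  then have "(\<Prod>i\<in>{0..<m}. U $$ (i,i)) \<noteq> 0"
    using R(2) unit_lower_det[OF L] upper_det[OF U] by simp
  then have Ud: "U $$ (i,i) \<noteq> 0" if "i < m" for i using that by auto
  \<comment> \<open>Apart from the last column, \<open>Z\<close> shows the columns of
    \<open>U\<close> moved to the left; its subdiagonal comes from the diagonal of
    \<open>U\<close>.\<close>
  have Zi: "Z $$ (l,j) = U $$ (l, Suc j)" if "l < m" "Suc j < m" for l j
  proof -
    have "Z $$ (l,j) = (\<Sum>p\<in>{0..<m}. if p = Suc j then U $$ (l,p) else 0)"
      using that U C by (auto simp: Z_def scalar_prod_def Ci mult_if_one_zero)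
    then show ?thesis using that by simp
  qed
  obtain G G' \<rho> where G: "inverse_pair m G G'" and \<rho>: "\<rho> \<in> carrier_mat 1 m" and ZG: "Z = G' * ?c * G + ?u * \<rho>"
    by (rule hessenberg_first_row[OF Z m]) (use Zi U(2) Ud in auto)
  define Q where "Q = G' * ?c * G"
  define Q' where "Q' = G' * ?c\<^sup>T * G"
  have KG: "K \<in> carrier_mat m m" "K' \<in> carrier_mat m m" "G \<in> carrier_mat m m" "G' \<in> carrier_mat m m"
    "K * K' = 1\<^sub>m m" "K' * K = 1\<^sub>m m" "G * G' = 1\<^sub>m m" "G' * G = 1\<^sub>m m"
    using K G by (auto simp: inverse_pair_def)
  have cT: "?c\<^sup>T \<in> carrier_mat m m" by (simp add: cyclic_mat_def)
  note cs = R(1) L(1) U(1) C X Z KG(1-4) \<rho> cT cyclic_mat_carrier[of m, where 'a = 'a] unit_col_carrier[of m, where 'a = 'a]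
  note d = cs[THEN carrier_matD(1)] cs[THEN carrier_matD(2)]
  have Q: "Q \<in> carrier_mat m m" "Q' \<in> carrier_mat m m"
    unfolding Q_def Q'_def by (rule carrier_matI; simp add: d)+
  note d = d carrier_matD[OF Q(1)] carrier_matD[OF Q(2)]
  have QQ: "Q' * Q = 1\<^sub>m m"
    unfolding Q_def Q'_def
    by (simp add: d mat_mult_assoc mat_inverse_left[OF KG(7)] mat_inverse_left[OF cyclic_mat_orthogonal(1)] KG)
  \<comment> \<open>Rewriting the change of the first row as a left factor
    \<open>1 + unit_col m * \<sigma>\<close> yields the candidate \<open>- \<sigma>\<close> for
    \<open>w\<close>.\<close>
  define \<sigma> where "\<sigma> = \<rho> * Q'"
  have \<sigma>: "\<sigma> \<in> carrier_mat 1 m" unfolding \<sigma>_def by (rule carrier_matI; simp add: d)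
  note d = d carrier_matD[OF \<sigma>]
  have ZQ: "(1\<^sub>m m + ?u * \<sigma>) * Q = Z"
    unfolding ZG Q_def[symmetric] \<sigma>_def
    by (simp add: d mat_add_mult mat_mult_assoc QQ mat_units)
  have detQ: "det Q = det ?c" "det X = det ?c"
    unfolding Q_def X_def LC
    by (rule det_conjugate[OF inverse_pair_swap[OF G] cyclic_mat_carrier] det_conjugate[OF inverse_pair_swap[OF K] cyclic_mat_carrier])+
  have detc: "det ?c \<noteq> 0"
    by (rule inverse_det_nonzero(1)[OF cyclic_mat_carrier cT cyclic_mat_orthogonal(2)])
  have "det Z = det X" unfolding RX[symmetric] using R X by (simp add: det_mult[of _ m])
  moreover have "det Z = (1 + \<sigma> $$ (0,0)) * det Q"
    unfolding ZQ[symmetric] det_one_plus_unit_col(1)[OF \<sigma> m, symmetric]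
    by (rule det_mult[of _ m]; rule carrier_matI; simp add: d)
  ultimately have \<sigma>0: "\<sigma> $$ (0,0) = 0" using detQ detc by auto
  have \<sigma>u: "\<sigma> * ?u = 0\<^sub>m 1 1"
    unfolding det_one_plus_unit_col(2)[OF \<sigma> m] \<sigma>0 by (intro eq_matI) auto
  have \<sigma>u': "\<sigma> * (?u * Y) = 0\<^sub>m 1 m" if "Y \<in> carrier_mat 1 m" for Y
  proof -
    have "\<sigma> * (?u * Y) = \<sigma> * ?u * Y" using that by (simp add: d mat_mult_assoc)
    then show ?thesis unfolding \<sigma>u using that by simp
  qed
  \<comment> \<open>\<open>X\<close> and \<open>Q\<close> are conjugates of one cyclic matrix, by
    \<open>K\<close> and \<open>G\<close>; \<open>W\<close> connects them.\<close>
  define W where "W = G' * K"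
  define W' where "W' = K' * G"
  have WW: "inverse_pair m W W'"
    unfolding W_def W'_def by (rule inverse_pair_mult[OF K inverse_pair_swap[OF G]])
  have "(1\<^sub>m m + ?u * (- \<sigma>)) * R * X = (1\<^sub>m m + ?u * (- \<sigma>)) * (R * X)"
    by (simp add: d mat_mult_assoc)
  also have "\<dots> = (1\<^sub>m m + ?u * (- \<sigma>)) * ((1\<^sub>m m + ?u * \<sigma>) * Q)" unfolding RX ZQ ..
  also have "\<dots> = (1\<^sub>m m + ?u * \<sigma> - ?u * \<sigma> - ?u * (\<sigma> * (?u * \<sigma>))) * Q"
    by (simp add: d mat_ring)
  also have "\<dots> = Q" unfolding \<sigma>u'[OF \<sigma>] by (simp add: d mat_ring)
  also have "\<dots> = W * X * W'"
    unfolding Q_def W_def W'_def X_def LC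
    by (simp add: d mat_mult_assoc mat_inverse_left[OF KG(5)])
  finally have "(1\<^sub>m m + ?u * (- \<sigma>)) * R * X = W * X * W'" .
  moreover have "- \<sigma> * ?u = 0\<^sub>m 1 1" using \<sigma>u by (simp add: d mat_uminus_mult mat_cancel)
  ultimately show thesis using that[of "- \<sigma>" X W W'] \<sigma> X WW detQ detc by auto
qed

text \<open>A basis starting with \<open>s\<close> reduces this to \<open>unit_col m\<close>. The
  inverse \<open>A\<close> of \<open>R\<close> is factorised, since \<open>A * U = L\<close> in that
  basis reads \<open>R * L = U\<close>.\<close>

lemma transvection_commutator:
  fixes R :: "'a::field mat"
  assumes R: "R \<in> carrier_mat m m" "det R = 1" and s: "s \<in> carrier_mat m 1" "s \<noteq> 0\<^sub>m m 1" and m: "m > 0"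
  obtains w X W W' where "w \<in> carrier_mat 1 m" "X \<in> carrier_mat m m" "det X \<noteq> 0" "inverse_pair m W W'"
    "w * s = 0\<^sub>m 1 1" "(1\<^sub>m m + s * w) * R * X = W * X * W'"
proof -
  obtain A where A: "A \<in> carrier_mat m m" "R * A = 1\<^sub>m m" "A * R = 1\<^sub>m m"
    using det_nonzero_inverse[OF R(1)] R(2) by auto
  have "det A \<noteq> 0" by (rule inverse_det_nonzero(2)[OF R(1) A(1,2)])
  from LU_similar[OF A(1) this s(1) disjI2[OF s(2)]]
  obtain g g' L U where g: "inverse_pair m g g'" and c: "L \<in> carrier_mat m m" "U \<in> carrier_mat m m"
    and gs: "g * s = unit_col m" and AU: "g * A * g' * U = L"
    and L: "\<forall>i<m. L $$ (i,i) = 1" "\<forall>i j. i < j \<longrightarrow> j < m \<longrightarrow> L $$ (i,j) = 0"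
    and U: "\<forall>i j. j < i \<longrightarrow> i < m \<longrightarrow> U $$ (i,j) = 0"
    by (elim exE conjE) (rule that)
  have gc: "g \<in> carrier_mat m m" "g' \<in> carrier_mat m m" "g * g' = 1\<^sub>m m" "g' * g = 1\<^sub>m m"
    using g by (auto simp: inverse_pair_def)
  note cs = R(1) A(1) gc(1,2) c s(1)
  note d = cs[THEN carrier_matD(1)] cs[THEN carrier_matD(2)]
  let ?R = "g * R * g'"
  have Rc: "?R \<in> carrier_mat m m" by (rule carrier_matI; simp add: d)
  have detR: "det ?R = 1" unfolding det_conjugate[OF g R(1)] by (rule R(2))
  have RL: "?R * L = U"
    unfolding AU[symmetric]
    by (simp add: d mat_mult_assoc mat_inverse_left[OF gc(4)] mat_inverse_left[OF A(2)] mat_inverse_left[OF gc(3)])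
  obtain w X W W' where w: "w \<in> carrier_mat 1 m" and X: "X \<in> carrier_mat m m" "det X \<noteq> 0" and W: "inverse_pair m W W'"
    and wu: "w * unit_col m = 0\<^sub>m 1 1" and eq: "(1\<^sub>m m + unit_col m * w) * ?R * X = W * X * W'"
    by (rule transvection_commutator_LU[OF Rc detR m c(1) L c(2) U RL]) blast
  have Wc: "W \<in> carrier_mat m m" "W' \<in> carrier_mat m m" using W by (auto simp: inverse_pair_def)
  note d = d carrier_matD[OF w] carrier_matD[OF X(1)] carrier_matD[OF Wc(1)] carrier_matD[OF Wc(2)]
  have "(1\<^sub>m m + s * (w * g)) * R * (g' * X * g) = g' * ((1\<^sub>m m + (g * s) * w) * ?R * X) * g"
    by (simp add: d mat_mult_assoc mat_add_mult mat_mult_add mat_units mat_inverse_left[OF gc(4)])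
  also have "\<dots> = (g' * W * g) * (g' * X * g) * (g' * W' * g)"
    unfolding gs eq by (simp add: d mat_mult_assoc mat_inverse_left[OF gc(3)])
  finally have 1: "(1\<^sub>m m + s * (w * g)) * R * (g' * X * g) = (g' * W * g) * (g' * X * g) * (g' * W' * g)" .
  have 2: "w * g * s = 0\<^sub>m 1 1" using wu gs by (simp add: d mat_mult_assoc)
  have 3: "inverse_pair m (g' * W * g) (g' * W' * g)"
    using inverse_pair_mult[OF inverse_pair_mult[OF g W] inverse_pair_swap[OF g]] Wc gc
    by simp
  have 4: "det (g' * X * g) \<noteq> 0" unfolding det_conjugate[OF inverse_pair_swap[OF g] X(1)] by (rule X(2))
  have 5: "w * g \<in> carrier_mat 1 m" "g' * X * g \<in> carrier_mat m m" by (rule carrier_matI; simp add: d)+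
  show thesis by (rule that[OF 5 4 3 2 1])
qed

section \<open>Assembly of the six factors\<close>

lemma balanced_SL:
  fixes E :: "'a::field mat"
  assumes n: "n > 0" and E: "E \<in> carrier_mat n n" "det E = 1"
  shows "balanced n E"
proof (cases "\<exists>c. E = c \<cdot>\<^sub>m 1\<^sub>m n")
  case True
  then obtain c where c: "E = c \<cdot>\<^sub>m 1\<^sub>m n" by blast
  then have "c ^ n = 1" using E(2) by simp
  then show ?thesis unfolding c by (rule balanced_scalar[OF n])
next
  case False
  obtain m where nm: "n = 1 + m" using n by (metis add.commute Suc_eq_plus1 gr0_implies_Suc)
  obtain g g' r s S where g: "inverse_pair (1 + m) g g'" and c: "r \<in> carrier_mat 1 m" "s \<in> carrier_mat m 1" "S \<in> carrier_mat m m"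
    and s: "s \<noteq> 0\<^sub>m m 1" and b: "g * E * g' = four_block_mat (1\<^sub>m 1) r s S"
    by (rule nonscalar_similar_block[of E m]) (use E(1) False nm in auto)
  note d = c[THEN carrier_matD(1)] c[THEN carrier_matD(2)]
  \<comment> \<open>Schur complement of the corner 1; it inherits the determinant of
    \<open>E\<close>.\<close>
  define R where "R = S - s * r"
  have R: "R \<in> carrier_mat m m" unfolding R_def by (rule carrier_matI; simp add: d)
  have S: "S = R + s * r" unfolding R_def using c by (intro eq_matI) auto
  have "four_block_mat (1\<^sub>m 1) r s S = four_block_mat (1\<^sub>m 1) (0\<^sub>m 1 m) s (1\<^sub>m m) * four_block_mat (1\<^sub>m 1) r (0\<^sub>m m 1) R"
    unfolding S using c R
    by (subst lower_mult[of _ m 1 _ 1 _ m]) (auto simp: mat_add_commute mat_units intro!: cong_four_block_mat)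
  moreover have "four_block_mat (1\<^sub>m 1) r (0\<^sub>m m 1) R \<in> carrier_mat (1 + m) (1 + m)"
    by (rule carrier_matI) (simp_all add: d carrier_matD[OF R])
  ultimately have "det (four_block_mat (1\<^sub>m 1) r s S) = det (four_block_mat (1\<^sub>m 1) r (0\<^sub>m m 1) R)"
    by (simp only: det_lower_mult[OF c(2)])
  also have "\<dots> = det R"
    using c R by (subst det_four_block_mat_lower_left_zero[of _ 1 _ m]) auto
  finally have "det (four_block_mat (1\<^sub>m 1) r s S) = det R" .
  then have detR: "det R = 1" using det_conjugate[OF g, of E] E nm unfolding b by simp
  have "m > 0"
  proof (rule ccontr)
    assume "\<not> m > 0"
    then have "s = 0\<^sub>m m 1" using c by (intro eq_matI) auto
    then show False using s by simp
  qed
  then obtain w X W W' where w: "w \<in> carrier_mat 1 m" and X: "X \<in> carrier_mat m m" "det X \<noteq> 0" and W: "inverse_pair m W W'"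
    and ws: "w * s = 0\<^sub>m 1 1" and eq: "(1\<^sub>m m + s * w) * R * X = W * X * W'"
    using transvection_commutator[OF R detR c(2) s] by blast
  have Wc: "W \<in> carrier_mat m m" "W' \<in> carrier_mat m m" "W * W' = 1\<^sub>m m" "W' * W = 1\<^sub>m m"
    using W by (auto simp: inverse_pair_def)
  have bal: "balanced (1 + m) (g * E * g')"
    unfolding b S by (rule balanced_block_transvection[OF c(1,2) R w X(1) Wc(1,2) Wc(3,4) X(2) ws eq])
  have gc: "g \<in> carrier_mat n n" "g' \<in> carrier_mat n n" "g * g' = 1\<^sub>m n" "g' * g = 1\<^sub>m n"
    using g nm by (auto simp: inverse_pair_def)
  note dg = carrier_matD[OF gc(1)] carrier_matD[OF gc(2)] carrier_matD[OF E(1)]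
  have "balanced n (g' * (g * E * g') * g)"
    by (rule balanced_similar[OF bal[folded nm] _ gc(2,1) gc(4,3)]) (rule carrier_matI; simp add: dg)
  moreover have "g' * (g * E * g') * g = E"
    by (simp add: dg mat_mult_assoc mat_inverse_left[OF gc(4)] gc mat_units)
  ultimately show ?thesis by simp
qed

lemma six_factors_suffice:
  fixes M :: "'a::field mat"
  assumes n: "n > 0" and M: "M \<in> SL (2 * n)"
  shows "\<exists>A1 \<in> carrier_mat n n. \<exists>A2 \<in> carrier_mat n n. \<exists>A3 \<in> carrier_mat n n.
      \<exists>A4 \<in> carrier_mat n n. \<exists>A5 \<in> carrier_mat n n. \<exists>A6 \<in> carrier_mat n n.
        M = four_block_mat (1\<^sub>m n) (0\<^sub>m n n) A1 (1\<^sub>m n)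
          * four_block_mat (1\<^sub>m n) A2 (0\<^sub>m n n) (1\<^sub>m n)
          * four_block_mat (1\<^sub>m n) (0\<^sub>m n n) A3 (1\<^sub>m n)
          * four_block_mat (1\<^sub>m n) A4 (0\<^sub>m n n) (1\<^sub>m n)
          * four_block_mat (1\<^sub>m n) (0\<^sub>m n n) A5 (1\<^sub>m n)
          * four_block_mat (1\<^sub>m n) A6 (0\<^sub>m n n) (1\<^sub>m n)"
proof -
  have Mc: "M \<in> carrier_mat (n + n) (n + n)" and detM: "det M = 1" using M by (auto simp: SL_def mult_2)
  obtain A B C0 D0 where c0: "A \<in> carrier_mat n n" "B \<in> carrier_mat n n" "C0 \<in> carrier_mat n n" "D0 \<in> carrier_mat n n"
    and Mb: "M = four_block_mat A B C0 D0"
    by (rule four_block_cases[OF Mc])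
  \<comment> \<open>The first \<open>n\<close> columns of \<open>M\<close> are independent: a common
    kernel vector of \<open>A\<close> and \<open>C0\<close>, padded with zeros, would lie in the
    kernel of \<open>M\<close>.\<close>
  obtain f where f: "f \<in> carrier_mat n n" and detC: "det (C0 + f * A) \<noteq> 0"
  proof (rule exists_invertible_add_mult[OF c0(1,3)])
    fix v :: "'a vec" assume v: "v \<in> carrier_vec n" "A *\<^sub>v v = 0\<^sub>v n" "C0 *\<^sub>v v = 0\<^sub>v n"
    have "M *\<^sub>v (v @\<^sub>v 0\<^sub>v n) = (A *\<^sub>v v + B *\<^sub>v 0\<^sub>v n) @\<^sub>v (C0 *\<^sub>v v + D0 *\<^sub>v 0\<^sub>v n)"
      unfolding Mb by (rule four_block_mat_mult_vec[OF c0]) (use v in auto)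
    also have "\<dots> = 0\<^sub>v (n + n)" using v c0 by (intro eq_vecI) auto
    finally have "M *\<^sub>v (v @\<^sub>v 0\<^sub>v n) = 0\<^sub>v (n + n)" .
    moreover have "v @\<^sub>v 0\<^sub>v n \<in> carrier_vec (n + n)" using v by simp
    ultimately have "v @\<^sub>v 0\<^sub>v n = 0\<^sub>v (n + n)"
      using detM det_0_iff_vec_prod_zero[OF Mc] by (metis zero_neq_one)
    then have "(v @\<^sub>v 0\<^sub>v n) $ i = 0" if "i < n" for i using that by simp
    then show "v = 0\<^sub>v n" using v by (intro eq_vecI) auto
  qed
  define C where "C = C0 + f * A"
  define D where "D = D0 + f * B"
  have c: "C \<in> carrier_mat n n" "D \<in> carrier_mat n n" using c0 f by (auto simp: C_def D_def)
  obtain C' where C': "C' \<in> carrier_mat n n" "C * C' = 1\<^sub>m n" "C' * C = 1\<^sub>m n"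
    using det_nonzero_inverse[OF c(1)] detC unfolding C_def by blast
  let ?M = "four_block_mat A B C D"
  have MM: "M = four_block_mat (1\<^sub>m n) (0\<^sub>m n n) (- f) (1\<^sub>m n) * ?M"
    unfolding Mb C_def D_def using c0 f
    by (subst lower_mult[of _ n n _ n _ n]) (auto simp: mat_ring intro!: cong_four_block_mat)
  have "det M = det ?M" unfolding MM using c0 c f by (intro det_lower_mult) auto
  define E where "E = C * (A * C' * D - B)"
  have E: "E \<in> carrier_mat n n" unfolding E_def
    by (rule carrier_matI) (simp_all add: carrier_matD[OF c(1)] carrier_matD[OF c0(2)])
  have "det E = 1"
    using det_four_block_lower_left_invertible[OF c0(1,2) c C'] \<open>det M = det ?M\<close> detM by (simp add: E_def)
  from balanced_SL[OF n E this]
  obtain a b V V' where cV: "a \<in> carrier_mat n n" "b \<in> carrier_mat n n" "V \<in> carrier_mat n n" "V' \<in> carrier_mat n n"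
    and V: "V * V' = 1\<^sub>m n" "V' * V = 1\<^sub>m n" and det: "det (1\<^sub>m n + b * a) \<noteq> 0"
    and eq: "E * (1\<^sub>m n + a * b) = V * (1\<^sub>m n + b * a) * V'"
    unfolding balanced_def by blast
  note cs = c0 c C'(1) cV f
  note d = cs[THEN carrier_matD(1)] cs[THEN carrier_matD(2)]
  \<comment> \<open>The similarity is by \<open>V\<close>, but the factorisation wants conjugation
    by \<open>C\<close>. These choices keep \<open>a * b\<close> and conjugate
    \<open>1 + b * a\<close> by \<open>C' * V\<close>, so that a further conjugation by
    \<open>C\<close> leaves the one by \<open>V\<close>.\<close>
  let ?a = "a * (V' * C)" and ?b = "C' * V * b"
  have ab: "?a * ?b = a * b"
    by (simp add: d mat_mult_assoc mat_inverse_left[OF C'(2)] mat_inverse_left[OF V(2)])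
  have ba: "1\<^sub>m n + ?b * ?a = (C' * V) * (1\<^sub>m n + b * a) * (V' * C)"
    by (simp add: d mat_mult_assoc mat_mult_add mat_add_mult mat_units mat_inverse_left[OF V(1)] C')
  have pair: "inverse_pair n (C' * V) (V' * C)"
    by (rule inverse_pair_mult) (use cs V C' in \<open>auto simp: inverse_pair_def\<close>)
  have "det (1\<^sub>m n + ?b * ?a) = det (1\<^sub>m n + b * a)"
    unfolding ba by (rule det_conjugate[OF pair], rule carrier_matI) (simp_all add: d)
  with det have det': "det (1\<^sub>m n + ?b * ?a) \<noteq> 0" by simp
  have eq': "C * (A * C' * D - B) * (1\<^sub>m n + ?a * ?b) = C * (1\<^sub>m n + ?b * ?a) * C'"
    unfolding ab E_def[symmetric] eq ba
    by (simp add: d mat_mult_assoc mat_inverse_left[OF C'(2)] C' mat_units)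
  have abc: "?a \<in> carrier_mat n n" "?b \<in> carrier_mat n n" by (rule carrier_matI; simp add: d)+
  obtain x y z where xyz: "x \<in> carrier_mat n n" "y \<in> carrier_mat n n" "z \<in> carrier_mat n n"
    and Me: "?M = four_block_mat (1\<^sub>m n) x (0\<^sub>m n n) (1\<^sub>m n)
      * (four_block_mat (1\<^sub>m n) (0\<^sub>m n n) y (1\<^sub>m n) * (four_block_mat (1\<^sub>m n) ?b (0\<^sub>m n n) (1\<^sub>m n)
      * (four_block_mat (1\<^sub>m n) (0\<^sub>m n n) ?a (1\<^sub>m n) * four_block_mat (1\<^sub>m n) z (0\<^sub>m n n) (1\<^sub>m n))))"
    using five_factors_if_lower_left_invertible[OF c0(1,2) c C' abc det' eq'] by blast
  show ?thesis
  proof (intro bexI)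
    show "M = four_block_mat (1\<^sub>m n) (0\<^sub>m n n) (- f) (1\<^sub>m n)
          * four_block_mat (1\<^sub>m n) x (0\<^sub>m n n) (1\<^sub>m n)
          * four_block_mat (1\<^sub>m n) (0\<^sub>m n n) y (1\<^sub>m n)
          * four_block_mat (1\<^sub>m n) ?b (0\<^sub>m n n) (1\<^sub>m n)
          * four_block_mat (1\<^sub>m n) (0\<^sub>m n n) ?a (1\<^sub>m n)
          * four_block_mat (1\<^sub>m n) z (0\<^sub>m n n) (1\<^sub>m n)"
      unfolding MM Me by (simp add: mat_mult_assoc d)
  qed (use xyz abc f in \<open>simp_all only: uminus_carrier_mat\<close>)
qed

theorem theorem0p1:
  shows "(\<forall>n>0. \<forall>M \<in> (SL (2 * n) :: 'a::field mat set).
      \<exists>A1 \<in> carrier_mat n n. \<exists>A2 \<in> carrier_mat n n. \<exists>A3 \<in> carrier_mat n n.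
      \<exists>A4 \<in> carrier_mat n n. \<exists>A5 \<in> carrier_mat n n. \<exists>A6 \<in> carrier_mat n n.
        M = four_block_mat (1\<^sub>m n) (0\<^sub>m n n) A1 (1\<^sub>m n)
          * four_block_mat (1\<^sub>m n) A2 (0\<^sub>m n n) (1\<^sub>m n)
          * four_block_mat (1\<^sub>m n) (0\<^sub>m n n) A3 (1\<^sub>m n)
          * four_block_mat (1\<^sub>m n) A4 (0\<^sub>m n n) (1\<^sub>m n)
          * four_block_mat (1\<^sub>m n) (0\<^sub>m n n) A5 (1\<^sub>m n)
          * four_block_mat (1\<^sub>m n) A6 (0\<^sub>m n n) (1\<^sub>m n))
    \<and> (\<forall>m>0. \<forall>n>0. m + n > 3 \<longrightarrow>
        (\<exists>M \<in> (SL (m + n) :: 'a mat set). M \<notin> mat_set_power (m + n) (BL m n \<union> BU m n) 5))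
    \<and> (infinite (UNIV :: 'a set) \<or> card (UNIV :: 'a set) \<ge> 4 \<longrightarrow>
        (\<forall>m>0. \<forall>n>0. m + n > 3 \<longrightarrow>
          (\<exists>M \<in> (SL (m + n) :: 'a mat set). \<forall>p. p permutes {0..<m + n} \<longrightarrow>
            perm_mat (m + n) p * M * perm_mat (m + n) (inv_into UNIV p)
              \<notin> mat_set_power (m + n) (BL m n \<union> BU m n) 5)))"
  using six_factors_suffice five_factors_insufficient five_factors_insufficient_permuted by blast

end
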